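(* Let $(P_{n,k}:n\ge1,\ 1\le k\le n)$ be an array of i.i.d. random variables in $[0,1]$ (fully random case), and consider the split-merge dynamics with splitting proportions $(P_{n,k})$, with transformed empirical distributions $\tilde G_n$. Assume that for some $p>2$ we have $$\mathbb{E}\left(|\log(P_{1,1})|^p\right)<\infty\quad\text{and}\quad\mathbb{E}\left(|\log(1-P_{1,1})|^p\right)<\infty.$$ Then there is a (deterministic) probability distribution $\tilde g$ on $[0,1]$ such that, almost surely, as $n\to\infty$, $\tilde G_n\Rightarrow\tilde g$ weakly on $[0,1]$. Moreover, $\tilde g$ is supported on $[x_*,1]$ for some $x_*\in(0,1)$, $\tilde g$ has no atoms in $[0,1)$, and $\tilde g(\{1\})=1-\mathbb{E}(P_{1,1})$.
   Context: Given random splitting proportions $(P_{n,k}:n\ge1,\ 1\le k\le n)$ in $[0,1]$, the break points of the split-merge dynamics are defined by $A_{n,0}=0$, $A_{n,n+1}=1$ for all $n\ge0$, and recursively for $n\ge1$, $$A_{n,k}=P_{n,k}\,A_{n-1,k-1}+(1-P_{n,k})\,A_{n-1,k},\qquad k=1,\dots,n.$$ The transformed empirical distributions are, for $n\ge1$, $$\tilde G_n=\frac1n\sum_{k=1}^n\delta_{\tilde A_{n,k}},\qquad \tilde A_{n,k}=A_{n,k}^{1/n},$$ where $\delta_a$ is the unit mass at $a$. Convention: $|\log 0|=\infty$. *)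

theory Defs
  imports "HOL-Probability.Probability"
begin

(* break_point P n k is the paper's A_{n,k}; indices k > n + 1 carry the dummy value 1. *)
fun break_point :: "(nat \<Rightarrow> nat \<Rightarrow> real) \<Rightarrow> nat \<Rightarrow> nat \<Rightarrow> real" where
  "break_point P 0 k = (if k = 0 then 0 else 1)"
| "break_point P (Suc n) k =
    (if k = 0 then 0
     else if k > Suc n then 1
     else P (Suc n) k * break_point P n (k - 1) + (1 - P (Suc n) k) * break_point P n k)"

definition transformed_point :: "(nat \<Rightarrow> nat \<Rightarrow> real) \<Rightarrow> nat \<Rightarrow> nat \<Rightarrow> real" where
  "transformed_point P n k = root n (break_point P n k)"

(* The image of the uniform distribution on {1..n}; see emeasure_transformed_empirical. *)
definition transformed_empirical :: "(nat \<Rightarrow> nat \<Rightarrow> real) \<Rightarrow> nat \<Rightarrow> real measure" where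
  "transformed_empirical P n = distr (uniform_count_measure {1..n}) borel (transformed_point P n)"

lemma emeasure_transformed_empirical:
  assumes "n \<ge> 1" and "B \<in> sets borel"
  shows "emeasure (transformed_empirical P n) B =
    ennreal (1 / real n * (\<Sum>k = 1..n. measure (return borel (transformed_point P n k)) B))"
proof -
  let ?S = "{k \<in> {1..n}. transformed_point P n k \<in> B}"
  have pre: "transformed_point P n -` B \<inter> space (uniform_count_measure {1..n}) = ?S"
    by (auto simp: space_uniform_count_measure)
  have "transformed_point P n \<in> measurable (uniform_count_measure {1..n}) borel"
    by (auto simp: measurable_def space_uniform_count_measure sets_uniform_count_measure)
  then have "emeasure (transformed_empirical P n) B = emeasure (uniform_count_measure {1..n}) ?S"
    unfolding transformed_empirical_def using assms(2) pre by (simp add: emeasure_distr)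
  also have "\<dots> = ennreal (real (card ?S) / real n)"
    by (subst emeasure_uniform_count_measure) auto
  also have "real (card ?S) = (\<Sum>k = 1..n. measure (return borel (transformed_point P n k)) B)"
  proof -
    have "(\<Sum>k = 1..n. measure (return borel (transformed_point P n k)) B) =
        (\<Sum>k = 1..n. if transformed_point P n k \<in> B then 1 else 0)"
      using assms(2) by (intro sum.cong) (auto simp: measure_return indicator_def)
    then show ?thesis
      by (simp only: sum.inter_filter[symmetric] finite_atLeastAtMost) simp
  qed
  finally show ?thesis by simp
qed

(* |log x|^p for x >= 0, with values in [0, infinity] because |log 0| = infinity, whereas ln 0 = 0. *)
definition abs_log_powr :: "real \<Rightarrow> real \<Rightarrow> ennreal" where
  "abs_log_powr p x = (if x = 0 then \<infinity> else ennreal (\<bar>ln x\<bar> powr p))"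

end

theory Submission
  imports Defs "HOL-Library.Discrete_Functions"
begin

text \<open>
  Fix the array of proportions and let a walk start at position \<open>k\<close> in row \<open>n\<close> and pass through
  the rows \<open>n, n - 1, \<dots>, 1\<close>, stepping in row \<open>i\<close> from \<open>j\<close> to \<open>j - 1\<close> with probability \<open>P i j\<close>.
  Then \<open>A n k\<close> is the probability that it makes fewer than \<open>k\<close> steps to the left, so
  \<open>ln (A n k) / n\<close> with \<open>k\<close> close to \<open>n u\<close> is a large deviation quantity of a random walk in a
  space-time random environment. The theorem says that it has a deterministic limit \<open>rate u\<close>, and
  the limit distribution is the law of \<open>exp (rate u)\<close> for \<open>u\<close> uniform on \<open>(0, 1)\<close>.

  The mean of \<open>ln (A n (k + 1))\<close> is superadditive in \<open>(n, k)\<close>: few steps in the upper rows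
  followed by few steps in the lower rows are few steps in all
  (\<open>break_point_supermultiplicative\<close>), and the proportions seen from a shifted apex have the same
  law. A two-parameter version of Fekete's argument yields the rate, and combining different
  directions shows that it is concave, hence continuous on \<open>(0, 1)\<close>.

  The logarithms concentrate at their means because their variance is at most of order \<open>n\<close>
  (\<open>variance_ln_weighted_le\<close>). A row of proportions changes a weighted sum of break points by a
  factor that is an average over the row, with weights that do not depend on this row. By Jensen's
  inequality its influence on the logarithm is therefore bounded in mean square by a second moment
  of \<open>ln (p (1 - p))\<close> for a single proportion \<open>p\<close>, however long the row is.

  The mean squares of the deviations are summable along the squares, which gives almost sure
  convergence there for all rational \<open>u\<close> at once. The break points of consecutive generations
  interlace, which fills the gaps between squares (\<open>ln_break_point_tendsto_if_squares\<close>).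

  The mean of \<open>A n k\<close> is a binomial distribution function with success probability the mean \<open>q\<close> of
  a proportion. The Chernoff bound for its lower tail gives \<open>rate u < 0\<close> for \<open>u < q\<close>. For \<open>u > q\<close>
  the other tail gives means close to \<open>1\<close>, and with the variance bound \<open>rate u = 0\<close>. So the limit
  distribution has mass \<open>1 - q\<close> at \<open>1\<close>. By concavity the rate is strictly increasing where it is
  negative, so there are no other atoms; it is bounded below because the first column alone keeps
  the break points above a product of independent factors \<open>1 - P i 1\<close>.
\<close>

section \<open>The dynamics for a fixed array of proportions\<close>

lemma break_point_left [simp]: "break_point P n 0 = 0"
  by (cases n) auto

lemma break_point_right: "n < k \<Longrightarrow> break_point P n k = 1"
  by (cases n) auto

lemma break_point_Suc_Suc:
  "k \<le> n \<Longrightarrow> break_point P (Suc n) (Suc k) =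
     P (Suc n) (Suc k) * break_point P n k + (1 - P (Suc n) (Suc k)) * break_point P n (Suc k)"
  by simp

lemma break_point_cong:
  assumes "\<And>i j. \<lbrakk>1 \<le> j; j \<le> i; i \<le> n\<rbrakk> \<Longrightarrow> P i j = Q i j"
  shows "break_point P n k = break_point Q n k"
  using assms by (induction n arbitrary: k) auto

lemma borel_measurable_break_point:
  assumes "\<And>i j. \<lbrakk>1 \<le> j; j \<le> i; i \<le> n\<rbrakk> \<Longrightarrow> (\<lambda>x. Q i j x) \<in> borel_measurable N"
  shows "(\<lambda>x. break_point (\<lambda>i j. Q i j x) n k) \<in> borel_measurable N"
  using assms
proof (induction n arbitrary: k)
  case (Suc n)
  have "(\<lambda>x. break_point (\<lambda>i j. Q i j x) n j) \<in> borel_measurable N" for j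
    by (rule Suc.IH) (auto intro: Suc.prems)
  moreover have "(\<lambda>x. Q (Suc n) k x) \<in> borel_measurable N" if "k \<noteq> 0" "k \<le> Suc n"
    using Suc.prems[of k "Suc n"] that by auto
  ultimately show ?case
    by (cases "k = 0"; cases "Suc n < k") auto
qed auto

lemmas [simp del] = break_point.simps

definition proportions :: "(nat \<Rightarrow> nat \<Rightarrow> real) \<Rightarrow> bool" where
  "proportions P \<longleftrightarrow> (\<forall>i j. 1 \<le> j \<longrightarrow> j \<le> i \<longrightarrow> 0 < P i j \<and> P i j < 1)"

lemma proportionsD: "\<lbrakk>proportions P; 1 \<le> j; j \<le> i\<rbrakk> \<Longrightarrow> 0 < P i j \<and> P i j < 1"
  by (simp add: proportions_def)

lemma proportions_shift:
  "\<lbrakk>proportions P; k \<le> n\<rbrakk> \<Longrightarrow> proportions (\<lambda>i j. P (n + i) (k + j))"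
  by (simp add: proportions_def)

lemma break_point_range:
  assumes "proportions P"
  shows "0 \<le> break_point P n k \<and> break_point P n k \<le> 1"
proof (induction n arbitrary: k)
  case 0
  show ?case by (simp add: break_point.simps)
next
  case (Suc n)
  show ?case
  proof (cases "1 \<le> k \<and> k \<le> Suc n")
    case True
    then have "0 < P (Suc n) k" "P (Suc n) k < 1"
      using assms by (auto simp: proportions_def)
    then have "P (Suc n) k * break_point P n (k - 1) + (1 - P (Suc n) k) * break_point P n k \<le> 1"
      using Suc.IH by (intro convex_bound_le) auto
    then show ?thesis
      using True Suc.IH \<open>0 < P (Suc n) k\<close> \<open>P (Suc n) k < 1\<close>
      by (simp add: break_point.simps)
  qed (auto simp: break_point.simps)
qed

lemma break_point_nonneg: "proportions P \<Longrightarrow> 0 \<le> break_point P n k"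
  and break_point_le_1: "proportions P \<Longrightarrow> break_point P n k \<le> 1"
  using break_point_range by auto

lemma convex_comb_between:
  fixes a b p :: real
  assumes "0 \<le> p" "p \<le> 1" "a \<le> b"
  shows "a \<le> p * a + (1 - p) * b" "p * a + (1 - p) * b \<le> b"
proof -
  have "0 \<le> p * (b - a)" "0 \<le> (1 - p) * (b - a)"
    using assms by simp_all
  then show "a \<le> p * a + (1 - p) * b" "p * a + (1 - p) * b \<le> b"
    by (simp_all add: algebra_simps)
qed

text \<open>
  Each new break point lies between the two old ones from which it is formed, so the break points
  of consecutive generations interlace; everything below that compares different times or
  positions rests on this.
\<close>

lemma break_point_le_Suc:
  assumes "proportions P"
  shows "break_point P n k \<le> break_point P n (Suc k)"
proof (induction n arbitrary: k)
  case 0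
  show ?case by (simp add: break_point.simps)
next
  case (Suc n)
  show ?case
  proof (cases "Suc k \<le> Suc n")
    case True
    then have r: "0 < P (Suc n) (Suc k)" "P (Suc n) (Suc k) < 1"
      using assms by (auto simp: proportions_def)
    have "break_point P (Suc n) k \<le> break_point P n k"
    proof (cases k)
      case (Suc l)
      then have "0 < P (Suc n) k" "P (Suc n) k < 1"
        using assms True by (auto simp: proportions_def)
      then show ?thesis
        using convex_comb_between(2)[of "P (Suc n) k" "break_point P n l" "break_point P n k"]
          Suc.IH[of l] Suc True by (simp add: break_point.simps)
    qed auto
    also have "\<dots> \<le> break_point P (Suc n) (Suc k)"
      using r convex_comb_between(1)[OF _ _ Suc.IH[of k], of "P (Suc n) (Suc k)"] True
        by (simp add: break_point.simps)
    finally show ?thesis .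
  next
    case False
    then show ?thesis
      using break_point_le_1[OF assms, of "Suc n" k] by (simp add: break_point_right)
  qed
qed

lemma break_point_mono:
  "\<lbrakk>proportions P; k \<le> l\<rbrakk> \<Longrightarrow> break_point P n k \<le> break_point P n l"
  using lift_Suc_mono_le[of "break_point P n"] break_point_le_Suc by blast

lemma break_point_interlace:
  assumes "proportions P"
  shows "break_point P (Suc n) k \<le> break_point P n k"
    and "break_point P n k \<le> break_point P (Suc n) (Suc k)"
proof -
  have "break_point P (Suc n) (Suc l) \<le> break_point P n (Suc l)
      \<and> break_point P n l \<le> break_point P (Suc n) (Suc l)" for l
  proof (cases "l \<le> n")
    case True
    then have "0 < P (Suc n) (Suc l)" "P (Suc n) (Suc l) < 1"
      using assms by (auto simp: proportions_def)
    then show ?thesis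
      using convex_comb_between[OF _ _ break_point_le_Suc[OF assms, of n l], of "P (Suc n) (Suc l)"]
        break_point_Suc_Suc[OF True, of P] by auto
  next
    case False
    then show ?thesis
      using break_point_le_1[OF assms] by (auto simp: break_point_right)
  qed
  note * = this
  show "break_point P n k \<le> break_point P (Suc n) (Suc k)"
    using * by blast
  show "break_point P (Suc n) k \<le> break_point P n k"
    using *[of "k - 1"] by (cases k) auto
qed

lemma break_point_decreasing:
  "proportions P \<Longrightarrow> break_point P (n + d) k \<le> break_point P n k"
proof (induction d)
  case (Suc d)
  then show ?case
    using break_point_interlace(1)[of P "n + d" k] by simp
qed simp

lemma break_point_increasing_diagonal:
  "proportions P \<Longrightarrow> break_point P n k \<le> break_point P (n + d) (k + d)"
proof (induction d)
  case (Suc d)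
  then show ?case
    using break_point_interlace(2)[of P "n + d" "k + d"] by simp
qed simp

lemma break_point_first:
  "break_point P n 1 = (\<Prod>i=1..n. 1 - P i 1)"
proof (induction n)
  case (Suc n)
  then show ?case
    using break_point_Suc_Suc[of 0 n P] by (simp add: mult.commute)
qed (simp add: break_point_right)

lemma break_point_ge_first:
  "\<lbrakk>proportions P; 1 \<le> k\<rbrakk> \<Longrightarrow> (\<Prod>i=1..n. 1 - P i 1) \<le> break_point P n k"
  using break_point_mono[of P 1 k n] break_point_first[of P n] by simp

lemma prod_first_pos: "proportions P \<Longrightarrow> 0 < (\<Prod>i=1..n. 1 - P i 1)"
  by (intro prod_pos) (auto simp: proportions_def)

lemma break_point_pos: "\<lbrakk>proportions P; 1 \<le> k\<rbrakk> \<Longrightarrow> 0 < break_point P n k"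
  using break_point_ge_first prod_first_pos less_le_trans by blast

text \<open>
  Read \<open>break_point P n k\<close> as the probability that a walk which starts at position \<open>k\<close> and
  runs through the rows \<open>n, n - 1, \<dots>, 1\<close>, moving from \<open>j\<close> to \<open>j - 1\<close> with probability \<open>P i j\<close> in
  row \<open>i\<close>, makes fewer than \<open>k\<close> moves. A walk that starts at \<open>k + l\<close> and makes fewer than \<open>l\<close> moves
  in the upper \<open>m\<close> rows leaves them at some \<open>j \<ge> k + 1\<close>. From there it succeeds in the lower \<open>n\<close> rows
  with probability \<open>break_point P n j\<close>, which is smallest for \<open>j = k + 1\<close>.
\<close>

lemma break_point_supermultiplicative:
  assumes P: "proportions P" and "k \<le> n"
  shows "break_point P n (Suc k) * break_point (\<lambda>i j. P (n + i) (k + j)) m l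
    \<le> break_point P (n + m) (k + l)"
proof (induction m arbitrary: l)
  case 0
  show ?case
    using break_point_mono[OF P, of "Suc k" "k + l" n] break_point_nonneg[OF P]
    by (cases l) (auto simp: break_point_right)
next
  case (Suc m)
  define a where "a = break_point P n (Suc k)"
  define Q where "Q = (\<lambda>i j. P (n + i) (k + j))"
  note IH = Suc.IH[folded a_def Q_def]
  have a: "0 \<le> a" "a \<le> 1"
    using break_point_range[OF P] by (auto simp: a_def)
  consider "l = 0" | "1 \<le> l" "l \<le> Suc m" | "Suc m < l" by linarith
  then have "a * break_point Q (Suc m) l \<le> break_point P (n + Suc m) (k + l)"
  proof cases
    case 1
    then show ?thesis using break_point_nonneg[OF P] by simp
  next
    case 2
    then obtain j where j: "l = Suc j" by (cases l) auto
    define p where "p = P (Suc (n + m)) (Suc (k + j))"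
    have p: "0 \<le> p" "p \<le> 1"
      using P 2 j \<open>k \<le> n\<close> by (auto simp: proportions_def p_def less_imp_le)
    have "a * break_point Q (Suc m) (Suc j)
        = p * (a * break_point Q m j) + (1 - p) * (a * break_point Q m (Suc j))"
      using 2 j by (simp add: break_point_Suc_Suc p_def Q_def algebra_simps)
    also have "\<dots> \<le> p * break_point P (n + m) (k + j) + (1 - p) * break_point P (n + m) (Suc (k + j))"
      using p IH[of j] IH[of "Suc j"] by (intro add_mono mult_left_mono) auto
    also have "\<dots> = break_point P (Suc (n + m)) (Suc (k + j))"
      using 2 j \<open>k \<le> n\<close> by (simp add: break_point_Suc_Suc p_def)
    finally show ?thesis by (simp add: j)
  next
    case 3
    have "a \<le> break_point P (n + Suc m) (Suc k + Suc m)"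
      unfolding a_def by (rule break_point_increasing_diagonal[OF P])
    also have "\<dots> \<le> break_point P (n + Suc m) (k + l)"
      using 3 by (intro break_point_mono[OF P]) auto
    finally show ?thesis
      using 3 by (simp add: break_point_right)
  qed
  then show ?case by (simp add: a_def Q_def)
qed

section \<open>Superadditive functions on a cone\<close>

locale cone_superadditive =
  fixes F :: "nat \<Rightarrow> nat \<Rightarrow> real" and c :: real
  assumes superadd: "\<lbrakk>k \<le> n; l \<le> m\<rbrakk> \<Longrightarrow> F n k + F m l \<le> F (n + m) (k + l)"
    and mono: "k \<le> l \<Longrightarrow> F n k \<le> F n l"
    and lower: "- c * real n \<le> F n k"
    and upper: "F n k \<le> 0"
begin

text \<open>
  Taking the supremum over all lattice points of slope at most \<open>x\<close>, and not only of slope close to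
  \<open>x\<close>, costs nothing for a monotone \<open>F\<close>. It makes the upper bound trivial for every real \<open>x\<close>.
\<close>

definition rate :: "real \<Rightarrow> real" where
  "rate x = (SUP (n, k) \<in> {(n, k). 1 \<le> n \<and> k \<le> n \<and> real k \<le> real n * x}. F n k / real n)"

lemma rate_upper:
  assumes "k \<le> n" "real k \<le> real n * x"
  shows "F n k \<le> real n * rate x"
proof (cases "n = 0")
  case True
  then show ?thesis using upper[of 0 k] by simp
next
  case False
  have "F n k / real n \<le> rate x"
    unfolding rate_def
    by (rule cSUP_upper2[where x = "(n, k)"])
       (use assms False in \<open>auto intro!: bdd_aboveI2[where M = 0] divide_nonpos_nonneg upper\<close>)
  then show ?thesis using False by (simp add: field_simps)
qed

lemma index_nonempty: "0 \<le> x \<Longrightarrow> {(n, k). 1 \<le> n \<and> k \<le> n \<and> real k \<le> real n * x} \<noteq> {}"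
proof -
  assume "0 \<le> x"
  then have "(1, 0) \<in> {(n, k). 1 \<le> n \<and> k \<le> n \<and> real k \<le> real n * x}" by simp
  then show ?thesis by blast
qed

lemma rate_le: "\<lbrakk>0 \<le> x; \<And>n k. \<lbrakk>1 \<le> n; k \<le> n; real k \<le> real n * x\<rbrakk> \<Longrightarrow> F n k \<le> real n * B\<rbrakk> \<Longrightarrow> rate x \<le> B"
  unfolding rate_def
  by (rule cSUP_least)
     (use index_nonempty[of x] in \<open>auto simp: divide_simps mult.commute\<close>)

lemma less_rateD:
  assumes "y < rate x" "0 \<le> x"
  obtains n k where "1 \<le> n" "k \<le> n" "real k \<le> real n * x" "y < F n k / real n"
proof -
  have "\<exists>z\<in>{(n, k). 1 \<le> n \<and> k \<le> n \<and> real k \<le> real n * x}. y < (case z of (n, k) \<Rightarrow> F n k / real n)"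
    using assms unfolding rate_def
    by (subst (asm) less_cSUP_iff)
       (use index_nonempty[of x] in \<open>auto intro!: bdd_aboveI2[where M = 0] divide_nonpos_nonneg upper\<close>)
  then show ?thesis using that by auto
qed

lemma rate_nonpos: "0 \<le> x \<Longrightarrow> rate x \<le> 0"
  by (rule rate_le) (use upper in auto)

lemma rate_lower: "0 \<le> x \<Longrightarrow> - c \<le> rate x"
  using rate_upper[of 0 1 x] lower[of 1 0] by simp

lemma c_nonneg: "0 \<le> c"
  using lower[of 1 0] upper[of 1 0] by simp

lemma F_multiple: "k \<le> n \<Longrightarrow> real a * F n k \<le> F (a * n) (a * k)"
proof (induction a)
  case 0
  then show ?case using lower[of 0 0] by simp
next
  case (Suc a)
  then show ?case
    using superadd[of k n "a * k" "a * n"] by (simp add: algebra_simps)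
qed

text \<open>
  Fekete's argument: if \<open>F N K / N\<close> is close to the supremum, then \<open>a\<close> copies of the vector
  \<open>(N, K)\<close> and a remainder of at most \<open>N\<close> steps in the direction \<open>(1, 0)\<close> fit below \<open>(n, n x)\<close>.
\<close>

lemma F_over_n_tendsto_rate:
  assumes x: "0 \<le> x" "x \<le> 1"
  shows "(\<lambda>n. F n (nat \<lfloor>real n * x\<rfloor>) / real n) \<longlonglongrightarrow> rate x"
proof (rule order_tendstoI)
  fix y assume "y < rate x"
  then obtain N K where NK: "1 \<le> N" "K \<le> N" "real K \<le> real N * x" "y < F N K / real N"
    using less_rateD x by metis
  define v where "v = F N K / real N"
  have v: "v \<le> 0" "F N K = v * real N"
    using NK upper[of N K] by (auto simp: v_def divide_nonpos_pos)
  have bound: "v - c * real N / real n \<le> F n (nat \<lfloor>real n * x\<rfloor>) / real n" if "1 \<le> n" for n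
  proof -
    define a r where "a = n div N" and "r = n mod N"
    have n: "n = a * N + r" by (simp add: a_def r_def)
    have r: "r < N" using NK by (simp add: r_def)
    have "real (a * K) \<le> real a * (real N * x)"
      using NK(3) by (simp add: mult_left_mono)
    also have "\<dots> \<le> real n * x"
      using x by (simp add: n algebra_simps)
    finally have aK: "a * K \<le> nat \<lfloor>real n * x\<rfloor>"
      by (simp add: le_nat_floor)
    have "real n * v - c * real N \<le> real a * F N K - c * real r"
    proof -
      have "real r * v \<le> 0" using v by (simp add: mult_nonneg_nonpos)
      moreover have "c * real r \<le> c * real N" using c_nonneg r by (simp add: mult_left_mono)
      ultimately show ?thesis by (simp add: n v algebra_simps)
    qed
    also have "\<dots> \<le> F (a * N) (a * K) + F r 0"
      using F_multiple[OF NK(2), of a] lower[of r 0] by simp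
    also have "\<dots> \<le> F n (a * K)"
      using superadd[of "a * K" "a * N" 0 r] NK(2) by (simp add: n)
    also have "\<dots> \<le> F n (nat \<lfloor>real n * x\<rfloor>)"
      by (rule mono[OF aK])
    finally have "(real n * v - c * real N) / real n \<le> F n (nat \<lfloor>real n * x\<rfloor>) / real n"
      by (intro divide_right_mono) auto
    then show ?thesis using that by (simp add: diff_divide_distrib)
  qed
  have "(\<lambda>n. v - c * real N / real n) \<longlonglongrightarrow> v - 0"
    by (intro tendsto_intros lim_const_over_n)
  then have "eventually (\<lambda>n. y < v - c * real N / real n) sequentially"
    using NK(4) by (intro order_tendstoD(1)) (auto simp: v_def)
  with eventually_ge_at_top[of 1]
  show "eventually (\<lambda>n. y < F n (nat \<lfloor>real n * x\<rfloor>) / real n) sequentially"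
    by eventually_elim (use bound in \<open>auto intro: less_le_trans\<close>)
next
  fix y assume y: "rate x < y"
  have floor: "nat \<lfloor>real n * x\<rfloor> \<le> n \<and> real (nat \<lfloor>real n * x\<rfloor>) \<le> real n * x" for n
  proof -
    have *: "real (nat \<lfloor>real n * x\<rfloor>) \<le> real n * x"
      using x by (intro of_nat_floor) auto
    also have "\<dots> \<le> real n * 1"
      using x by (intro mult_left_mono) auto
    finally show ?thesis using * by simp
  qed
  have "F n (nat \<lfloor>real n * x\<rfloor>) / real n \<le> rate x" if "1 \<le> n" for n
    using rate_upper[of "nat \<lfloor>real n * x\<rfloor>" n x] floor[of n] that by (simp add: field_simps)
  with y show "eventually (\<lambda>n. F n (nat \<lfloor>real n * x\<rfloor>) / real n < y) sequentially"
    by (intro eventually_sequentiallyI[of 1]) (meson le_less_trans)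
qed

text \<open>
  To reach the direction \<open>(1 - t) x + t y\<close>, spend a fraction \<open>t\<close> of the time in direction \<open>y\<close>
  and the rest in direction \<open>x\<close>.
\<close>

lemma rate_concave: "concave_on {0..1} rate"
  unfolding concave_on_def
proof (rule convex_on_linorderI)
  fix t x y :: real
  assume t: "0 < t" "t < 1" and xy: "x \<in> {0..1}" "y \<in> {0..1}" "x < y"
  define z where "z = (1 - t) * x + t * y"
  have z: "0 \<le> z" "z \<le> 1"
    using t xy convex_bound_le[of x 1 y "1 - t" t] by (auto simp: z_def)
  \<comment> \<open>The rounded part goes with the larger slope \<open>y\<close>, so that the combined position stays below \<open>N z\<close>.\<close>
  define n where "n = (\<lambda>N. nat \<lfloor>real N * t\<rfloor>)"
  define m where "m = (\<lambda>N. N - n N)"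
  have nN: "real (n N) \<le> real N * t" for N
    unfolding n_def using t by (intro of_nat_floor) auto
  have nN': "n N \<le> N" for N
  proof -
    have "real N * t \<le> real N * 1" using t by (intro mult_left_mono) auto
    with nN[of N] show ?thesis by simp
  qed
  have m: "real (m N) = real N - real (n N)" for N
    using nN'[of N] by (simp add: m_def)
  have step: "F (n N) (nat \<lfloor>real (n N) * y\<rfloor>) + F (m N) (nat \<lfloor>real (m N) * x\<rfloor>)
      \<le> F N (nat \<lfloor>real N * z\<rfloor>)" for N
  proof -
    have fl: "nat \<lfloor>real i * u\<rfloor> \<le> i \<and> real (nat \<lfloor>real i * u\<rfloor>) \<le> real i * u" if "u \<in> {0..1}" for i u
    proof -
      have *: "real (nat \<lfloor>real i * u\<rfloor>) \<le> real i * u"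
        using that by (intro of_nat_floor) auto
      also have "\<dots> \<le> real i * 1"
        using that by (intro mult_left_mono) auto
      finally show ?thesis using * by simp
    qed
    have "real (n N) * y + real (m N) * x = real N * x + real (n N) * (y - x)"
      by (simp add: m algebra_simps)
    also have "\<dots> \<le> real N * x + real N * t * (y - x)"
      using nN[of N] xy by (intro add_left_mono mult_right_mono) auto
    also have "\<dots> = real N * z" by (simp add: z_def algebra_simps)
    finally have "nat \<lfloor>real (n N) * y\<rfloor> + nat \<lfloor>real (m N) * x\<rfloor> \<le> nat \<lfloor>real N * z\<rfloor>"
      using fl[OF xy(2), of "n N"] fl[OF xy(1), of "m N"]
      by (intro le_nat_floor, unfold of_nat_add) linarith
    then show ?thesis
      using superadd[of "nat \<lfloor>real (n N) * y\<rfloor>" "n N" "nat \<lfloor>real (m N) * x\<rfloor>" "m N"]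
        fl[OF xy(2), of "n N"] fl[OF xy(1), of "m N"] nN'[of N]
        mono[of "nat \<lfloor>real (n N) * y\<rfloor> + nat \<lfloor>real (m N) * x\<rfloor>" "nat \<lfloor>real N * z\<rfloor>" N]
      by (simp add: m_def)
  qed
  have lim_n: "(\<lambda>N. real (n N) / real N) \<longlonglongrightarrow> t"
  proof (rule tendsto_sandwich)
    have "t - 1 / real N \<le> real (n N) / real N" if "1 \<le> N" for N
    proof -
      have "real N * t - 1 \<le> real (n N)" unfolding n_def by linarith
      then have "(real N * t - 1) / real N \<le> real (n N) / real N"
        by (intro divide_right_mono) auto
      then show ?thesis using that by (simp add: diff_divide_distrib)
    qed
    then show "eventually (\<lambda>N. t - 1 / real N \<le> real (n N) / real N) sequentially"
      by (rule eventually_sequentiallyI)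
    show "eventually (\<lambda>N. real (n N) / real N \<le> t) sequentially"
      using nN by (intro eventually_sequentiallyI[of 1]) (simp add: field_simps)
    have "(\<lambda>N. t - 1 / real N) \<longlonglongrightarrow> t - 0"
      by (intro tendsto_intros lim_const_over_n)
    then show "(\<lambda>N. t - 1 / real N) \<longlonglongrightarrow> t" by simp
  qed simp
  have "(\<lambda>N. 1 - real (n N) / real N) \<longlonglongrightarrow> 1 - t"
    by (intro tendsto_intros lim_n)
  then have lim_m: "(\<lambda>N. real (m N) / real N) \<longlonglongrightarrow> 1 - t"
    by (rule Lim_transform_eventually)
       (auto intro!: eventually_sequentiallyI[of 1] simp: m field_simps)
  have part: "(\<lambda>N. F (i N) (nat \<lfloor>real (i N) * u\<rfloor>) / real N) \<longlonglongrightarrow> rate u * s"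
    if i: "(\<lambda>N. real (i N) / real N) \<longlonglongrightarrow> s" and "0 < s" and "u \<in> {0..1}" for i u s
  proof -
    have top: "filterlim (\<lambda>N. real (i N) / real N * real N) at_top sequentially"
      by (rule filterlim_tendsto_pos_mult_at_top[OF i \<open>0 < s\<close> filterlim_real_sequentially])
    have ev: "eventually (\<lambda>N. real (i N) / real N * real N = real (i N)) sequentially"
      by (intro eventually_sequentiallyI[of 1]) simp
    have "filterlim (\<lambda>N. real (i N)) at_top sequentially"
      by (rule filterlim_cong[OF refl refl ev, THEN iffD1, OF top])
    then have i_top: "filterlim i sequentially sequentially"
      by (simp add: filterlim_sequentially_iff_filterlim_real)
    have "(\<lambda>N. F (i N) (nat \<lfloor>real (i N) * u\<rfloor>) / real (i N)) \<longlonglongrightarrow> rate u"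
      using that by (intro filterlim_compose[OF F_over_n_tendsto_rate i_top]) auto
    then have "(\<lambda>N. F (i N) (nat \<lfloor>real (i N) * u\<rfloor>) / real (i N) * (real (i N) / real N)) \<longlonglongrightarrow> rate u * s"
      by (intro tendsto_mult i)
    moreover have "eventually (\<lambda>N. 1 \<le> i N) sequentially"
      by (rule eventually_compose_filterlim[OF eventually_ge_at_top i_top])
    ultimately show ?thesis
      by (elim Lim_transform_eventually eventually_mono) simp
  qed
  have "rate y * t + rate x * (1 - t) \<le> rate z"
  proof (rule tendsto_le[OF _ F_over_n_tendsto_rate[OF z] tendsto_add[OF part[OF lim_n] part[OF lim_m]]])
    show "eventually (\<lambda>N. F (n N) (nat \<lfloor>real (n N) * y\<rfloor>) / real N + F (m N) (nat \<lfloor>real (m N) * x\<rfloor>) / real N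
        \<le> F N (nat \<lfloor>real N * z\<rfloor>) / real N) sequentially"
      using step by (auto intro!: always_eventually divide_right_mono simp flip: add_divide_distrib)
  qed (use t xy in auto)
  then show "- rate ((1 - t) *\<^sub>R x + t *\<^sub>R y) \<le> (1 - t) * - rate x + t * - rate y"
    by (simp add: z_def algebra_simps)
qed (rule convex_real_interval)

lemma rate_continuous: "continuous_on {0<..<1} rate"
proof -
  have "convex_on {0<..<1} (\<lambda>x. - rate x)"
    using rate_concave unfolding concave_on_def by (rule convex_on_subset) auto
  then have "continuous_on {0<..<1} (\<lambda>x. - rate x)"
    by (intro convex_on_continuous) auto
  then have "continuous_on {0<..<1} (\<lambda>x. - (- rate x))"
    by (rule continuous_on_minus)
  then show ?thesis by simp
qed

text \<open>
  A concave function that reaches its maximum \<open>0\<close> to the right of a point with a negative value is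
  still strictly increasing at that point.
\<close>

lemma rate_strict_mono:
  assumes "0 \<le> x" "x < y" "y < z" "z \<le> 1" "rate z = 0" "rate y < 0"
  shows "rate x < rate y"
proof -
  define t where "t = (y - x) / (z - x)"
  have t: "0 < t" "t < 1"
    using assms by (auto simp: t_def)
  have "t * (z - x) = y - x"
    using assms by (simp add: t_def)
  then have y: "y = (1 - t) * x + t * z"
    by (simp add: algebra_simps)
  have "(1 - t) * rate x + t * rate z \<le> rate y"
    using concave_onD[OF rate_concave, of t x z] t assms by (simp add: y)
  then have le: "(1 - t) * rate x \<le> rate y" using assms by simp
  show ?thesis
  proof (rule ccontr)
    assume "\<not> rate x < rate y"
    then have "(1 - t) * rate y \<le> (1 - t) * rate x" using t by (intro mult_left_mono) auto
    with le have "0 \<le> t * rate y" by (simp add: algebra_simps)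
    moreover have "t * rate y < 0" using t assms by (simp add: mult_pos_neg)
    ultimately show False by simp
  qed
qed

end

section \<open>Square integrable random variables\<close>

definition square_integrable :: "'a measure \<Rightarrow> ('a \<Rightarrow> real) \<Rightarrow> bool" where
  "square_integrable M f \<longleftrightarrow> f \<in> borel_measurable M \<and> integrable M (\<lambda>x. (f x)\<^sup>2)"

lemma square_integrable_measurable: "square_integrable M f \<Longrightarrow> f \<in> borel_measurable M"
  and square_integrableD: "square_integrable M f \<Longrightarrow> integrable M (\<lambda>x. (f x)\<^sup>2)"
  by (auto simp: square_integrable_def)

lemma square_integrable_bound:
  assumes "square_integrable M g" "f \<in> borel_measurable M"
    and "\<And>x. x \<in> space M \<Longrightarrow> \<bar>f x\<bar> \<le> \<bar>g x\<bar>"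
  shows "square_integrable M f"
  unfolding square_integrable_def
proof
  show "integrable M (\<lambda>x. (f x)\<^sup>2)"
    using assms
    by (intro Bochner_Integration.integrable_bound[OF square_integrableD[OF assms(1)]])
       (auto simp: abs_le_square_iff)
qed fact

lemma square_integrable_add:
  assumes "square_integrable M f" "square_integrable M g"
  shows "square_integrable M (\<lambda>x. f x + g x)"
proof -
  note [measurable] = assms[THEN square_integrable_measurable]
  have "(f x + g x)\<^sup>2 \<le> 2 * (f x)\<^sup>2 + 2 * (g x)\<^sup>2" for x
    using sum_squares_bound[of "f x" "g x"] by (simp add: power2_sum)
  moreover have "integrable M (\<lambda>x. 2 * (f x)\<^sup>2 + 2 * (g x)\<^sup>2)"
    using assms[THEN square_integrableD] by auto
  ultimately have "integrable M (\<lambda>x. (f x + g x)\<^sup>2)"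
    by (elim Bochner_Integration.integrable_bound) auto
  then show ?thesis
    by (simp add: square_integrable_def)
qed

lemma square_integrable_minus:
  "square_integrable M f \<Longrightarrow> square_integrable M (\<lambda>x. - f x)"
  by (simp add: square_integrable_def)

lemma square_integrable_diff:
  "\<lbrakk>square_integrable M f; square_integrable M g\<rbrakk> \<Longrightarrow> square_integrable M (\<lambda>x. f x - g x)"
  using square_integrable_add[of M f "\<lambda>x. - g x"] square_integrable_minus[of M g] by simp

lemma square_integrable_abs:
  "square_integrable M f \<Longrightarrow> square_integrable M (\<lambda>x. \<bar>f x\<bar>)"
  by (auto simp: square_integrable_def)

lemma (in finite_measure) square_integrable_const: "square_integrable M (\<lambda>x. c)"
  by (simp add: square_integrable_def)

lemma (in finite_measure) square_integrable_sum:
  "(\<And>i. i \<in> I \<Longrightarrow> square_integrable M (f i)) \<Longrightarrow> square_integrable M (\<lambda>x. \<Sum>i\<in>I. f i x)"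
  by (induction I rule: infinite_finite_induct)
     (auto intro: square_integrable_add square_integrable_const)

lemma (in finite_measure) square_integrable_imp_integrable':
  "square_integrable M f \<Longrightarrow> integrable M f"
  unfolding square_integrable_def by (auto intro: square_integrable_imp_integrable)

lemma (in prob_space) expectation_square_dist:
  assumes "square_integrable M f"
  shows "expectation (\<lambda>x. (f x - c)\<^sup>2) = variance f + (expectation f - c)\<^sup>2"
proof -
  have [simp]: "integrable M f" "integrable M (\<lambda>x. (f x)\<^sup>2)"
    using assms by (auto simp: square_integrable_imp_integrable' square_integrableD)
  show ?thesis
    by (simp add: variance_eq power2_diff prob_space algebra_simps) (simp add: power2_eq_square)
qed

lemma (in prob_space) square_expectation_le:
  assumes "square_integrable M f"
  shows "(expectation f)\<^sup>2 \<le> expectation (\<lambda>x. (f x)\<^sup>2)"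
  using expectation_square_dist[OF assms, of 0] variance_positive[of f] by simp

lemma (in pair_prob_space) square_integrable_snd:
  assumes "square_integrable M2 g"
  shows "square_integrable (M1 \<Otimes>\<^sub>M M2) (\<lambda>z. g (snd z))"
proof -
  note [measurable] = square_integrable_measurable[OF assms]
  have "integrable (M1 \<Otimes>\<^sub>M M2) (\<lambda>z. (g (snd z))\<^sup>2)"
    using square_integrableD[OF assms] by (intro Fubini_integrable) auto
  then show ?thesis by (simp add: square_integrable_def)
qed

text \<open>
  A form of the law of total variance. The total variance is the mean of the variances over the
  fibres plus the variance of the fibre means, and the latter is at most their mean square
  distance to the constant \<open>\<integral>g\<close>, for which Jensen's inequality brings in the distance of \<open>f\<close> to
  \<open>g\<close>.
\<close>

lemma (in pair_prob_space) variance_le_fibre_variance: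
  fixes f :: "'a \<times> 'b \<Rightarrow> real"
  assumes f: "square_integrable (M1 \<Otimes>\<^sub>M M2) f"
    and g: "square_integrable M2 g"
    and fibre: "\<And>u. u \<in> space M1 \<Longrightarrow> square_integrable M2 (\<lambda>v. f (u, v))"
    and s: "\<And>u. u \<in> space M1 \<Longrightarrow> M2.variance (\<lambda>v. f (u, v)) \<le> s"
    and t: "expectation (\<lambda>z. (f z - g (snd z))\<^sup>2) \<le> t"
  shows "variance f \<le> s + t"
proof -
  have fg: "square_integrable (M1 \<Otimes>\<^sub>M M2) (\<lambda>z. f z - g (snd z))"
    by (intro square_integrable_diff f square_integrable_snd g)
  define c where "c = M2.expectation g"
  have fc: "square_integrable (M1 \<Otimes>\<^sub>M M2) (\<lambda>z. f z - c)"
    by (intro square_integrable_diff f square_integrable_const)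
  have pointwise: "M2.expectation (\<lambda>v. (f (u, v) - c)\<^sup>2)
      \<le> s + M2.expectation (\<lambda>v. (f (u, v) - g v)\<^sup>2)" if u: "u \<in> space M1" for u
  proof -
    have "M2.expectation (\<lambda>v. f (u, v)) - c = M2.expectation (\<lambda>v. f (u, v) - g v)"
      unfolding c_def using fibre[OF u] g
      by (simp add: M2.square_integrable_imp_integrable')
    then have "(M2.expectation (\<lambda>v. f (u, v)) - c)\<^sup>2 \<le> M2.expectation (\<lambda>v. (f (u, v) - g v)\<^sup>2)"
      using M2.square_expectation_le[OF square_integrable_diff[OF fibre[OF u] g]] by simp
    then show ?thesis
      using M2.expectation_square_dist[OF fibre[OF u], of c] s[OF u] by simp
  qed
  have "variance f \<le> expectation (\<lambda>z. (f z - c)\<^sup>2)"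
    using expectation_square_dist[OF f, of c] by simp
  also have "\<dots> = M1.expectation (\<lambda>u. M2.expectation (\<lambda>v. (f (u, v) - c)\<^sup>2))"
    using integral_fst'[OF square_integrableD[OF fc]] by simp
  also have "\<dots> \<le> M1.expectation (\<lambda>u. s + M2.expectation (\<lambda>v. (f (u, v) - g v)\<^sup>2))"
    using integrable_fst'[OF square_integrableD[OF fc]] integrable_fst'[OF square_integrableD[OF fg]]
    by (intro integral_mono pointwise) auto
  also have "\<dots> = s + expectation (\<lambda>z. (f z - g (snd z))\<^sup>2)"
    using integral_fst'[OF square_integrableD[OF fg]] integrable_fst'[OF square_integrableD[OF fg]]
    by (simp add: M1.prob_space)
  finally show ?thesis using t by simp
qed

text \<open>
  With two independent points of the space as arguments, expectations over independent variables
  become iterated integrals.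
\<close>

lemma (in prob_space) distr_indep_pair:
  assumes "indep_var S U T V"
  shows "distr M (S \<Otimes>\<^sub>M T) (\<lambda>x. (U x, V x)) = distr (M \<Otimes>\<^sub>M M) (S \<Otimes>\<^sub>M T) (\<lambda>(x, y). (U x, V y))"
proof -
  have UV: "random_variable S U" "random_variable T V"
    and "distr M S U \<Otimes>\<^sub>M distr M T V = distr M (S \<Otimes>\<^sub>M T) (\<lambda>x. (U x, V x))"
    using assms unfolding indep_var_distribution_eq by auto
  moreover have "sigma_finite_measure (distr M T V)"
    using UV prob_space.prob_space_distr prob_space_axioms prob_space_imp_sigma_finite by blast
  ultimately show ?thesis
    using pair_measure_distr[OF UV] by simp
qed

lemma (in prob_space)
  fixes h :: "'b \<times> 'b \<Rightarrow> real"
  assumes indep: "indep_var S U T V" and h: "h \<in> borel_measurable (S \<Otimes>\<^sub>M T)"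
  shows integrable_decouple:
      "integrable M (\<lambda>x. h (U x, V x)) \<longleftrightarrow> integrable (M \<Otimes>\<^sub>M M) (\<lambda>(x, y). h (U x, V y))"
    and integral_decouple:
      "(\<integral>x. h (U x, V x) \<partial>M) = (\<integral>z. (case z of (x, y) \<Rightarrow> h (U x, V y)) \<partial>(M \<Otimes>\<^sub>M M))"
proof -
  have [measurable]: "random_variable S U" "random_variable T V"
    using indep unfolding indep_var_distribution_eq by auto
  note [measurable] = h
  show "integrable M (\<lambda>x. h (U x, V x)) \<longleftrightarrow> integrable (M \<Otimes>\<^sub>M M) (\<lambda>(x, y). h (U x, V y))"
    using integrable_distr_eq[of "\<lambda>x. (U x, V x)" M "S \<Otimes>\<^sub>M T" h]
      integrable_distr_eq[of "\<lambda>(x, y). (U x, V y)" "M \<Otimes>\<^sub>M M" "S \<Otimes>\<^sub>M T" h]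
      distr_indep_pair[OF indep] by (simp add: case_prod_beta')
  show "(\<integral>x. h (U x, V x) \<partial>M) = (\<integral>z. (case z of (x, y) \<Rightarrow> h (U x, V y)) \<partial>(M \<Otimes>\<^sub>M M))"
    using integral_distr[of "\<lambda>x. (U x, V x)" M "S \<Otimes>\<^sub>M T" h]
      integral_distr[of "\<lambda>(x, y). (U x, V y)" "M \<Otimes>\<^sub>M M" "S \<Otimes>\<^sub>M T" h]
      distr_indep_pair[OF indep] by (simp add: case_prod_beta')
qed

section \<open>Logarithms of weighted sums\<close>

lemma convex_on_ln_square: "convex_on {0<..1} (\<lambda>x::real. (ln x)\<^sup>2)"
proof (rule f''_ge0_imp_convex)
  fix x :: real assume x: "x \<in> {0<..1}"
  then show "((\<lambda>x. (ln x)\<^sup>2) has_real_derivative 2 * ln x / x) (at x)"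
    by (auto intro!: derivative_eq_intros)
  show "((\<lambda>x. 2 * ln x / x) has_real_derivative 2 * (1 - ln x) / x\<^sup>2) (at x)"
    using x by (auto intro!: derivative_eq_intros simp: power2_eq_square diff_divide_distrib)
  show "0 \<le> 2 * (1 - ln x) / x\<^sup>2"
  proof -
    have "ln x \<le> 0" using x by simp
    then show ?thesis by (intro divide_nonneg_nonneg) auto
  qed
qed auto

text \<open>
  The quotient of the two sums is an average of the ratios \<open>B j / C j\<close>, which lie between \<open>s j\<close>
  and \<open>1\<close>, and \<open>(ln x)\<^sup>2\<close> is decreasing and convex there. The weights of the average depend on \<open>w\<close> and \<open>C\<close>
  only, so that the bound can be integrated over random \<open>s j\<close> that are independent of them, at a cost that
  does not grow with the number of summands.
\<close>

lemma ln_ratio_square_le: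
  fixes w B C s :: "'i \<Rightarrow> real"
  assumes "finite J"
    and w: "\<And>j. j \<in> J \<Longrightarrow> 0 \<le> w j"
    and C: "\<And>j. j \<in> J \<Longrightarrow> 0 < C j"
    and s: "\<And>j. j \<in> J \<Longrightarrow> 0 < s j \<and> s j \<le> 1"
    and B: "\<And>j. j \<in> J \<Longrightarrow> s j * C j \<le> B j \<and> B j \<le> C j"
    and pos: "0 < (\<Sum>j\<in>J. w j * C j)"
  shows "(ln (\<Sum>j\<in>J. w j * B j) - ln (\<Sum>j\<in>J. w j * C j))\<^sup>2
    \<le> (\<Sum>j\<in>J. w j * C j / (\<Sum>j\<in>J. w j * C j) * (ln (s j))\<^sup>2)"
proof -
  define D where "D = (\<Sum>j\<in>J. w j * C j)"
  define \<nu> where "\<nu> j = w j * C j / D" for j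
  have D: "0 < D" using pos by (simp add: D_def)
  have J: "J \<noteq> {}" using pos by auto
  have \<nu>: "0 \<le> \<nu> j" if "j \<in> J" for j
    using w[OF that] C[OF that] D by (simp add: \<nu>_def)
  have \<nu>1: "(\<Sum>j\<in>J. \<nu> j) = 1"
    using D by (simp add: \<nu>_def D_def flip: sum_divide_distrib)
  define \<rho> where "\<rho> = (\<Sum>j\<in>J. \<nu> j * s j)"
  define r where "r = (\<Sum>j\<in>J. w j * B j) / D"
  obtain i where i: "i \<in> J" "0 < \<nu> i"
    using \<nu>1 sum_nonpos[of J \<nu>] by (metis not_less zero_less_one not_le)
  have "0 \<le> \<nu> j * s j" if "j \<in> J" for j
    using \<nu>[OF that] s[OF that] by simp
  moreover have "0 < \<nu> i * s i" using i s[OF i(1)] by simp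
  ultimately have \<rho>_pos: "0 < \<rho>"
    unfolding \<rho>_def by (intro sum_pos2[OF \<open>finite J\<close> i(1)])
  have "\<rho> = (\<Sum>j\<in>J. w j * (s j * C j)) / D"
    by (simp add: \<rho>_def \<nu>_def sum_divide_distrib algebra_simps)
  also have "\<dots> \<le> r"
    unfolding r_def using B w D by (intro divide_right_mono sum_mono mult_left_mono) auto
  finally have \<rho>_le: "\<rho> \<le> r" .
  have "(\<Sum>j\<in>J. w j * B j) \<le> D"
    unfolding D_def using B w by (intro sum_mono mult_left_mono) auto
  then have r1: "r \<le> 1" using D by (simp add: r_def)
  have r0: "0 < r" using \<rho>_pos \<rho>_le by simp
  then have "0 < (\<Sum>j\<in>J. w j * B j)"
    using D by (simp add: r_def zero_less_divide_iff)
  then have "ln (\<Sum>j\<in>J. w j * B j) - ln D = ln r"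
    using D by (simp add: r_def ln_div)
  moreover have "(ln r)\<^sup>2 \<le> (ln \<rho>)\<^sup>2"
  proof -
    have "ln \<rho> \<le> ln r" "ln r \<le> 0"
      using \<rho>_pos \<rho>_le r0 r1 by auto
    then show ?thesis by (simp flip: abs_le_square_iff)
  qed
  moreover have "(ln \<rho>)\<^sup>2 \<le> (\<Sum>j\<in>J. \<nu> j * (ln (s j))\<^sup>2)"
    unfolding \<rho>_def
    using convex_on_sum[OF \<open>finite J\<close> J convex_on_ln_square \<nu>1 \<nu>, of s] s by simp
  ultimately show ?thesis
    by (simp add: \<nu>_def D_def)
qed

section \<open>Random arrays\<close>

abbreviation triangle :: "nat \<Rightarrow> (nat \<times> nat) set" where
  "triangle n \<equiv> {(i, j). 1 \<le> j \<and> j \<le> i \<and> i \<le> n}"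

text \<open>
  Strict bounds on the proportions hold here at every point of the space, so that all break points
  with positive index are positive and their logarithms are genuine. The general case differs from
  this one by a null set.
\<close>

locale iid_proportions = prob_space M for M :: "'a measure" +
  fixes P :: "nat \<Rightarrow> nat \<Rightarrow> 'a \<Rightarrow> real"
  assumes proportions: "\<omega> \<in> space M \<Longrightarrow> proportions (\<lambda>i j. P i j \<omega>)"
    and indep: "indep_vars (\<lambda>_. borel) (\<lambda>(i, j). P i j) {(i, j). 1 \<le> j \<and> j \<le> i}"
    and identical: "\<lbrakk>1 \<le> j; j \<le> i\<rbrakk> \<Longrightarrow> distr M borel (P i j) = distr M borel (P 1 1)"
    and square_integrable_ln: "square_integrable M (\<lambda>\<omega>. ln (P 1 1 \<omega>))"
    and square_integrable_ln_1: "square_integrable M (\<lambda>\<omega>. ln (1 - P 1 1 \<omega>))"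
begin

lemma measurable_P: "\<lbrakk>1 \<le> j; j \<le> i\<rbrakk> \<Longrightarrow> P i j \<in> borel_measurable M"
  using indep unfolding indep_vars_def by auto

definition A :: "nat \<Rightarrow> nat \<Rightarrow> 'a \<Rightarrow> real" where
  "A n k \<omega> = break_point (\<lambda>i j. P i j \<omega>) n k"

lemma measurable_A [measurable]: "A n k \<in> borel_measurable M"
  unfolding A_def by (intro borel_measurable_break_point measurable_P)

lemma A_pos: "\<lbrakk>\<omega> \<in> space M; 1 \<le> k\<rbrakk> \<Longrightarrow> 0 < A n k \<omega>"
  and A_nonneg: "\<omega> \<in> space M \<Longrightarrow> 0 \<le> A n k \<omega>"
  and A_le_1: "\<omega> \<in> space M \<Longrightarrow> A n k \<omega> \<le> 1"
  unfolding A_def using proportions break_point_pos break_point_nonneg break_point_le_1 by blast+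

lemma A_mono: "\<lbrakk>\<omega> \<in> space M; k \<le> l\<rbrakk> \<Longrightarrow> A n k \<omega> \<le> A n l \<omega>"
  unfolding A_def by (intro break_point_mono proportions)

lemma
  fixes f :: "real \<Rightarrow> real"
  assumes f: "f \<in> borel_measurable borel" and ij: "1 \<le> j" "j \<le> i"
  shows integrable_identical: "integrable M (\<lambda>\<omega>. f (P i j \<omega>)) \<longleftrightarrow> integrable M (\<lambda>\<omega>. f (P 1 1 \<omega>))"
    and expectation_identical: "expectation (\<lambda>\<omega>. f (P i j \<omega>)) = expectation (\<lambda>\<omega>. f (P 1 1 \<omega>))"
proof -
  note [measurable] = f measurable_P[OF ij] measurable_P[OF order_refl order_refl]
  show "integrable M (\<lambda>\<omega>. f (P i j \<omega>)) \<longleftrightarrow> integrable M (\<lambda>\<omega>. f (P 1 1 \<omega>))"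
    using integrable_distr_eq[of "P i j" M borel f] integrable_distr_eq[of "P 1 1" M borel f]
    by (simp add: identical[OF ij] del: One_nat_def)
  show "expectation (\<lambda>\<omega>. f (P i j \<omega>)) = expectation (\<lambda>\<omega>. f (P 1 1 \<omega>))"
    using integral_distr[of "P i j" M borel f] integral_distr[of "P 1 1" M borel f]
    by (simp add: identical[OF ij] del: One_nat_def)
qed

lemma square_integrable_identical:
  fixes f :: "real \<Rightarrow> real"
  assumes f[measurable]: "f \<in> borel_measurable borel" and ij: "1 \<le> j" "j \<le> i"
    and sq: "square_integrable M (\<lambda>\<omega>. f (P 1 1 \<omega>))"
  shows "square_integrable M (\<lambda>\<omega>. f (P i j \<omega>))"
proof -
  have "(\<lambda>x. (f x)\<^sup>2) \<in> borel_measurable borel" by simp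
  from integrable_identical[OF this ij] show ?thesis
    using sq measurable_compose[OF measurable_P[OF ij] f] by (simp add: square_integrable_def)
qed

lemma ln_A_first:
  "\<omega> \<in> space M \<Longrightarrow> ln (A n 1 \<omega>) = (\<Sum>i=1..n. ln (1 - P i 1 \<omega>))"
  unfolding A_def break_point_first
proof (rule ln_prod)
  fix i assume "\<omega> \<in> space M" "i \<in> {1..n}"
  then show "1 - P i 1 \<omega> \<noteq> 0"
    using proportionsD[OF proportions, of \<omega> 1 i] by auto
qed simp

lemma square_integrable_ln_A_first: "square_integrable M (\<lambda>\<omega>. ln (A n 1 \<omega>))"
proof (rule square_integrable_bound)
  show "square_integrable M (\<lambda>\<omega>. \<Sum>i=1..n. ln (1 - P i 1 \<omega>))"
    using square_integrable_identical[where f = "\<lambda>x. ln (1 - x)", OF _ _ _ square_integrable_ln_1]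
    by (intro square_integrable_sum) auto
qed (simp_all only: ln_A_first order_refl, measurable)

text \<open>
  The first column alone controls how close a weighted sum of break points comes to \<open>0\<close>, and the
  logarithm of \<open>A n 1\<close> is a sum of finitely many square integrable terms.
\<close>

lemma square_integrable_ln_between:
  assumes "S \<in> borel_measurable M" "0 < a"
    and "\<And>\<omega>. \<omega> \<in> space M \<Longrightarrow> a * A n 1 \<omega> \<le> S \<omega> \<and> S \<omega> \<le> b"
  shows "square_integrable M (\<lambda>\<omega>. ln (S \<omega>))"
proof (rule square_integrable_bound)
  show "square_integrable M (\<lambda>\<omega>. \<bar>ln a\<bar> + \<bar>ln b\<bar> + \<bar>ln (A n 1 \<omega>)\<bar>)"
    by (intro square_integrable_add square_integrable_const square_integrable_abs
        square_integrable_ln_A_first)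
  fix \<omega> assume \<omega>: "\<omega> \<in> space M"
  have pos: "0 < a * A n 1 \<omega>" using assms(2) A_pos[OF \<omega>, of 1 n] by simp
  with assms(3)[OF \<omega>] have "ln (a * A n 1 \<omega>) \<le> ln (S \<omega>)" "ln (S \<omega>) \<le> ln b" by auto
  moreover have "ln (a * A n 1 \<omega>) = ln a + ln (A n 1 \<omega>)"
    using assms(2) A_pos[OF \<omega>, of 1 n] by (simp add: ln_mult)
  ultimately show "\<bar>ln (S \<omega>)\<bar> \<le> \<bar>\<bar>ln a\<bar> + \<bar>ln b\<bar> + \<bar>ln (A n 1 \<omega>)\<bar>\<bar>" by linarith
qed (use assms in simp)

lemma square_integrable_ln_A: "1 \<le> k \<Longrightarrow> square_integrable M (\<lambda>\<omega>. ln (A n k \<omega>))"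
  using A_mono[of _ 1 k n] A_le_1
  by (intro square_integrable_ln_between[where a = 1 and b = 1 and n = n]) auto

lemma integrable_ln_A: "1 \<le> k \<Longrightarrow> integrable M (\<lambda>\<omega>. ln (A n k \<omega>))"
  by (intro square_integrable_imp_integrable' square_integrable_ln_A)

lemma square_integrable_ln_weighted:
  assumes "finite J" "\<And>j. j \<in> J \<Longrightarrow> 1 \<le> j" "\<And>j. j \<in> J \<Longrightarrow> 0 \<le> w j" "0 < sum w J"
  shows "square_integrable M (\<lambda>\<omega>. ln (\<Sum>j\<in>J. w j * A n j \<omega>))"
proof (rule square_integrable_ln_between[where a = "sum w J" and b = "sum w J" and n = n])
  fix \<omega> assume \<omega>: "\<omega> \<in> space M"
  show "sum w J * A n 1 \<omega> \<le> (\<Sum>j\<in>J. w j * A n j \<omega>) \<and> (\<Sum>j\<in>J. w j * A n j \<omega>) \<le> sum w J"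
    unfolding sum_distrib_right
    using assms A_mono[OF \<omega>] A_le_1[OF \<omega>]
    by (auto intro!: sum_mono mult_left_mono mult_left_le)
qed (use assms in auto)

section \<open>The variance grows at most linearly\<close>

text \<open>
  To the right of the triangle all break points are \<open>1\<close>, so the recursion holds there with any
  proportion. The value \<open>1/2\<close> lets all positions be treated alike and has a harmless
  \<open>ln (p (1 - p))\<close>.
\<close>

definition full_row :: "nat \<Rightarrow> (nat \<times> nat \<Rightarrow> real) \<Rightarrow> nat \<Rightarrow> real" where
  "full_row n u j = (if 1 \<le> j \<and> j \<le> n then u (n, j) else 1 / 2)"

abbreviation row :: "nat \<Rightarrow> 'a \<Rightarrow> nat \<Rightarrow> real" where
  "row n \<omega> \<equiv> full_row n (\<lambda>(i, j). P i j \<omega>)"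

lemma row_range: "\<omega> \<in> space M \<Longrightarrow> 0 < row n \<omega> j \<and> row n \<omega> j < 1"
  using proportionsD[OF proportions, of \<omega> j n] by (auto simp: full_row_def)

lemma A_Suc:
  "1 \<le> j \<Longrightarrow> A (Suc n) j \<omega> = row (Suc n) \<omega> j * A n (j - 1) \<omega> + (1 - row (Suc n) \<omega> j) * A n j \<omega>"
  by (cases j; cases "j \<le> Suc n")
     (auto simp: A_def full_row_def break_point_Suc_Suc break_point_right)

text \<open>
  The adjoint of the recursion: the weights on generation \<open>n - 1\<close> that give the same weighted sum as
  the weights \<open>w\<close>, supported on \<open>{1..K}\<close>, on generation \<open>n\<close>. Position \<open>0\<close> is dropped, as the break point
  there is \<open>0\<close>.
\<close>

definition pull_back :: "nat \<Rightarrow> (nat \<Rightarrow> real) \<Rightarrow> (nat \<Rightarrow> real) \<Rightarrow> nat \<Rightarrow> real" where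
  "pull_back K w r j = w j * (1 - r j) + (if j < K then w (Suc j) * r (Suc j) else 0)"

lemma sum_pull_back:
  assumes "a 0 = 0"
  shows "(\<Sum>j=1..K. w j * (r j * a (j - 1) + (1 - r j) * a j)) = (\<Sum>j=1..K. pull_back K w r j * a j)"
proof -
  have "(\<Sum>j=1..K. w j * r j * a (j - 1)) = (\<Sum>j=1..K. (if j < K then w (Suc j) * r (Suc j) else 0) * a j)"
  proof (cases K)
    case (Suc L)
    have "(\<Sum>j=1..K. w j * r j * a (j - 1)) = (\<Sum>j=0..L. w (Suc j) * r (Suc j) * a j)"
      unfolding Suc using sum.shift_bounds_cl_Suc_ivl[of "\<lambda>j. w j * r j * a (j - 1)" 0 L] by simp
    also have "\<dots> = (\<Sum>j=1..L. w (Suc j) * r (Suc j) * a j)"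
      using assms by (simp add: sum.atLeast_Suc_atMost)
    also have "\<dots> = (\<Sum>j=1..K. (if j < K then w (Suc j) * r (Suc j) else 0) * a j)"
      unfolding Suc by simp
    finally show ?thesis .
  qed simp
  then show ?thesis
    by (simp add: pull_back_def algebra_simps sum.distrib sum_subtractf)
qed

lemma sum_pull_back_pos:
  assumes w: "\<And>j. j \<in> {1..K} \<Longrightarrow> 0 \<le> w j" and pos: "0 < (\<Sum>j=1..K. w j)"
    and r: "\<And>j. 0 < r j \<and> r j < 1"
  shows "j \<in> {1..K} \<Longrightarrow> 0 \<le> pull_back K w r j" and "0 < (\<Sum>j=1..K. pull_back K w r j)"
proof -
  have ge: "w j * (1 - r j) \<le> pull_back K w r j" if "j \<in> {1..K}" for j
    using that w[of "Suc j"] r[of "Suc j"] by (auto simp: pull_back_def)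
  have nonneg: "0 \<le> w j * (1 - r j)" if "j \<in> {1..K}" for j
    using w[OF that] r[of j] by simp
  show "0 \<le> pull_back K w r j" if "j \<in> {1..K}" for j
    using nonneg[OF that] ge[OF that] by simp
  obtain i where i: "i \<in> {1..K}" "0 < w i"
    using pos sum_nonpos[of "{1..K}" w] by (metis not_less)
  have "0 < (\<Sum>j=1..K. w j * (1 - r j))"
    using i r[of i] nonneg by (intro sum_pos2[OF _ i(1)]) auto
  also have "\<dots> \<le> (\<Sum>j=1..K. pull_back K w r j)"
    by (intro sum_mono ge)
  finally show "0 < (\<Sum>j=1..K. pull_back K w r j)" .
qed

text \<open>
  A bound for the mean square of \<open>ln (p (1 - p))\<close> at every position of a row; the second summand is
  its value at the added proportions \<open>1/2\<close>.
\<close>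

definition row_cost :: real where
  "row_cost = expectation (\<lambda>\<omega>. (ln (P 1 1 \<omega> * (1 - P 1 1 \<omega>)))\<^sup>2) + (ln (1 / 4))\<^sup>2"

lemma
  shows square_integrable_row_cost:
      "square_integrable M (\<lambda>\<omega>. ln (row n \<omega> j * (1 - row n \<omega> j)))"
    and expectation_row_cost:
      "expectation (\<lambda>\<omega>. (ln (row n \<omega> j * (1 - row n \<omega> j)))\<^sup>2) \<le> row_cost"
proof -
  have "square_integrable M (\<lambda>\<omega>. ln (P 1 1 \<omega> * (1 - P 1 1 \<omega>)))"
  proof (rule square_integrable_bound)
    show "square_integrable M (\<lambda>\<omega>. ln (P 1 1 \<omega>) + ln (1 - P 1 1 \<omega>))"
      by (intro square_integrable_add square_integrable_ln square_integrable_ln_1)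
    show "(\<lambda>\<omega>. ln (P 1 1 \<omega> * (1 - P 1 1 \<omega>))) \<in> borel_measurable M"
      using measurable_P[of 1 1] by measurable
    show "\<bar>ln (P 1 1 \<omega> * (1 - P 1 1 \<omega>))\<bar> \<le> \<bar>ln (P 1 1 \<omega>) + ln (1 - P 1 1 \<omega>)\<bar>"
      if "\<omega> \<in> space M" for \<omega>
      using proportionsD[OF proportions[OF that], of 1 1] by (simp add: ln_mult)
  qed
  note sq = this
  have "square_integrable M (\<lambda>\<omega>. ln (row n \<omega> j * (1 - row n \<omega> j)))
    \<and> expectation (\<lambda>\<omega>. (ln (row n \<omega> j * (1 - row n \<omega> j)))\<^sup>2) \<le> row_cost"
  proof (cases "1 \<le> j \<and> j \<le> n")
    case True
    then have j: "1 \<le> j" "j \<le> n" by auto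
    have [measurable]: "(\<lambda>x::real. ln (x * (1 - x))) \<in> borel_measurable borel"
      "(\<lambda>x::real. (ln (x * (1 - x)))\<^sup>2) \<in> borel_measurable borel"
      by measurable
    have "row n \<omega> j = P n j \<omega>" for \<omega>
      using True by (simp add: full_row_def)
    then show ?thesis
      using square_integrable_identical[OF _ j sq]
        expectation_identical[of "\<lambda>x. (ln (x * (1 - x)))\<^sup>2", OF _ j]
      unfolding row_cost_def by simp
  next
    case False
    then have "row n \<omega> j = 1 / 2" for \<omega>
      unfolding full_row_def by (rule if_not_P)
    then show ?thesis
      by (simp only:) (simp add: row_cost_def prob_space square_integrable_const)
  qed
  then show "square_integrable M (\<lambda>\<omega>. ln (row n \<omega> j * (1 - row n \<omega> j)))"
    and "expectation (\<lambda>\<omega>. (ln (row n \<omega> j * (1 - row n \<omega> j)))\<^sup>2) \<le> row_cost"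
    by auto
qed

lemma indep_row_triangle:
  "indep_var
    (Pi\<^sub>M {(i, j). 1 \<le> j \<and> j \<le> i \<and> i = Suc n} (\<lambda>_. borel))
      (\<lambda>\<omega>. restrict (\<lambda>(i, j). P i j \<omega>) {(i, j). 1 \<le> j \<and> j \<le> i \<and> i = Suc n})
    (Pi\<^sub>M (triangle n) (\<lambda>_. borel)) (\<lambda>\<omega>. restrict (\<lambda>(i, j). P i j \<omega>) (triangle n))"
  using indep_var_restrict[OF indep, of "{(i, j). 1 \<le> j \<and> j \<le> i \<and> i = Suc n}" "triangle n"]
  by (simp only: case_prod_beta') force

text \<open>
  Condition on the top row. Given this row, the sum is a weighted sum of the break points of the
  previous generation with pulled back weights, which is why the induction has to run over all
  weights at once; the induction hypothesis bounds the conditional variance. It remains to bound the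
  effect of the row. Whatever its proportions \<open>p j\<close> are, the new break points lie between
  \<open>p j (1 - p j) (A n (j - 1) + A n j)\<close> and \<open>A n (j - 1) + A n j\<close>, so replacing them by the latter
  removes the row and moves the logarithm by little in mean square.
\<close>

lemma variance_ln_weighted_le:
  assumes "\<And>j. j \<in> {1..K} \<Longrightarrow> 0 \<le> w j" "0 < (\<Sum>j=1..K. w j)"
  shows "variance (\<lambda>\<omega>. ln (\<Sum>j=1..K. w j * A n j \<omega>)) \<le> real n * row_cost"
  using assms
proof (induction n arbitrary: w)
  case 0
  have "(\<Sum>j=1..K. w j * A 0 j \<omega>) = (\<Sum>j=1..K. w j)" for \<omega>
    by (intro sum.cong) (auto simp: A_def break_point_right)
  then show ?case by (simp only:) (simp add: prob_space)
next
  case (Suc n)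
  interpret pair: pair_prob_space M M ..
  define R where "R = {(i, j). 1 \<le> j \<and> j \<le> i \<and> i = Suc n}"
  define T where "T = triangle n"
  define U where "U = (\<lambda>\<omega>. restrict (\<lambda>(i, j). P i j \<omega>) R)"
  define V where "V = (\<lambda>\<omega>. restrict (\<lambda>(i, j). P i j \<omega>) T)"
  have UV: "indep_var (Pi\<^sub>M R (\<lambda>_. borel)) U (Pi\<^sub>M T (\<lambda>_. borel)) V"
    unfolding R_def T_def U_def V_def by (rule indep_row_triangle)
  define h where "h = (\<lambda>z :: (nat \<times> nat \<Rightarrow> real) \<times> (nat \<times> nat \<Rightarrow> real).
    ln (\<Sum>j=1..K. pull_back K w (full_row (Suc n) (fst z)) j * break_point (\<lambda>i j. snd z (i, j)) n j))"
  have meas_row: "(\<lambda>z. full_row (Suc n) (fst z) j)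
      \<in> borel_measurable (Pi\<^sub>M R (\<lambda>_. borel) \<Otimes>\<^sub>M Pi\<^sub>M T (\<lambda>_. borel))" for j
  proof (cases "1 \<le> j \<and> j \<le> Suc n")
    case True
    then have "(Suc n, j) \<in> R" by (simp add: R_def)
    with True show ?thesis
      by (simp add: full_row_def measurable_compose[OF measurable_fst measurable_component_singleton])
  next
    case False
    then have "full_row (Suc n) u j = 1 / 2" for u
      unfolding full_row_def by (rule if_not_P)
    then show ?thesis by (simp only:) simp
  qed
  have meas_bp: "(\<lambda>z. break_point (\<lambda>i j. snd z (i, j)) n j)
      \<in> borel_measurable (Pi\<^sub>M R (\<lambda>_. borel) \<Otimes>\<^sub>M Pi\<^sub>M T (\<lambda>_. borel))" for j
    by (intro borel_measurable_break_point measurable_compose[OF measurable_snd measurable_component_singleton])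
       (auto simp: T_def)
  have meas_pull: "(\<lambda>z. pull_back K w (full_row (Suc n) (fst z)) j)
      \<in> borel_measurable (Pi\<^sub>M R (\<lambda>_. borel) \<Otimes>\<^sub>M Pi\<^sub>M T (\<lambda>_. borel))" for j
    unfolding pull_back_def
    by (cases "j < K"; simp only: if_True if_False;
        intro borel_measurable_add borel_measurable_times borel_measurable_diff
          borel_measurable_const meas_row)
  have h [measurable]: "h \<in> borel_measurable (Pi\<^sub>M R (\<lambda>_. borel) \<Otimes>\<^sub>M Pi\<^sub>M T (\<lambda>_. borel))"
    unfolding h_def
    by (intro borel_measurable_ln borel_measurable_sum borel_measurable_times meas_pull meas_bp)
  have rowU: "full_row (Suc n) (U \<omega>) = row (Suc n) \<omega>" for \<omega>
    by (auto simp: full_row_def U_def R_def)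
  have A_V: "break_point (\<lambda>i j. V \<omega> (i, j)) n j = A n j \<omega>" for \<omega> j
    unfolding A_def by (rule break_point_cong) (simp add: V_def T_def)
  have h_eq: "h (U \<omega>, V \<omega>') = ln (\<Sum>j=1..K. pull_back K w (row (Suc n) \<omega>) j * A n j \<omega>')" for \<omega> \<omega>'
    by (simp add: h_def rowU A_V)
  have h_eq': "h (U \<omega>, V \<omega>') = ln (\<Sum>j=1..K. w j *
      (row (Suc n) \<omega> j * A n (j - 1) \<omega>' + (1 - row (Suc n) \<omega> j) * A n j \<omega>'))" for \<omega> \<omega>'
    unfolding h_eq by (subst sum_pull_back) (simp_all add: A_def)
  define X where "X = (\<lambda>\<omega>. ln (\<Sum>j=1..K. w j * A (Suc n) j \<omega>))"
  have X_eq: "X \<omega> = h (U \<omega>, V \<omega>)" for \<omega>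
    unfolding X_def h_eq' by (intro arg_cong[where f = ln] sum.cong refl) (simp add: A_Suc)
  have sq_X: "square_integrable M X"
    unfolding X_def by (rule square_integrable_ln_weighted) (use Suc.prems in auto)
  \<comment> \<open>The first argument of \<open>f\<close> drives the top row and the second one all lower rows; \<open>g\<close> forgets the row.\<close>
  define f where "f = (\<lambda>(\<omega>, \<omega>'). h (U \<omega>, V \<omega>'))"
  define g where "g = (\<lambda>\<omega>. ln (\<Sum>j=1..K. w j * (A n (j - 1) \<omega> + A n j \<omega>)))"
  have [measurable]: "U \<in> measurable M (Pi\<^sub>M R (\<lambda>_. borel))" "V \<in> measurable M (Pi\<^sub>M T (\<lambda>_. borel))"
    using UV unfolding indep_var_distribution_eq by auto
  have sq_f: "square_integrable (M \<Otimes>\<^sub>M M) f"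
    unfolding square_integrable_def
  proof
    show "f \<in> borel_measurable (M \<Otimes>\<^sub>M M)" unfolding f_def by measurable
    have "(\<lambda>z. (h z)\<^sup>2) \<in> borel_measurable (Pi\<^sub>M R (\<lambda>_. borel) \<Otimes>\<^sub>M Pi\<^sub>M T (\<lambda>_. borel))"
      by measurable
    from integrable_decouple[OF UV this] square_integrableD[OF sq_X]
    show "integrable (M \<Otimes>\<^sub>M M) (\<lambda>z. (f z)\<^sup>2)"
      by (simp add: X_eq f_def case_prod_beta')
  qed
  have D_ge: "(\<Sum>j=1..K. w j) * A n 1 \<omega> \<le> (\<Sum>j=1..K. w j * (A n (j - 1) \<omega> + A n j \<omega>))"
    and D_le: "(\<Sum>j=1..K. w j * (A n (j - 1) \<omega> + A n j \<omega>)) \<le> 2 * (\<Sum>j=1..K. w j)"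
    if \<omega>: "\<omega> \<in> space M" for \<omega>
  proof -
    have "w j * A n 1 \<omega> \<le> w j * (A n (j - 1) \<omega> + A n j \<omega>)"
         "w j * (A n (j - 1) \<omega> + A n j \<omega>) \<le> 2 * w j" if j: "j \<in> {1..K}" for j
    proof -
      show "w j * A n 1 \<omega> \<le> w j * (A n (j - 1) \<omega> + A n j \<omega>)"
        using Suc.prems(1)[OF j] A_mono[OF \<omega>, of 1 j n] A_nonneg[OF \<omega>, of n "j - 1"] j
        by (intro mult_left_mono) auto
      have "w j * (A n (j - 1) \<omega> + A n j \<omega>) \<le> w j * 2"
        using Suc.prems(1)[OF j] A_le_1[OF \<omega>, of n j] A_le_1[OF \<omega>, of n "j - 1"]
        by (intro mult_left_mono) auto
      then show "w j * (A n (j - 1) \<omega> + A n j \<omega>) \<le> 2 * w j" by simp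
    qed
    then show "(\<Sum>j=1..K. w j) * A n 1 \<omega> \<le> (\<Sum>j=1..K. w j * (A n (j - 1) \<omega> + A n j \<omega>))"
      and "(\<Sum>j=1..K. w j * (A n (j - 1) \<omega> + A n j \<omega>)) \<le> 2 * (\<Sum>j=1..K. w j)"
      unfolding sum_distrib_right sum_distrib_left by (auto intro!: sum_mono)
  qed
  have sq_g: "square_integrable M g"
    unfolding g_def
    by (rule square_integrable_ln_between[where a = "\<Sum>j=1..K. w j" and b = "2 * (\<Sum>j=1..K. w j)" and n = n])
       (use Suc.prems D_ge D_le in auto)
  define \<nu> where "\<nu> = (\<lambda>j \<omega>. w j * (A n (j - 1) \<omega> + A n j \<omega>)
      / (\<Sum>j=1..K. w j * (A n (j - 1) \<omega> + A n j \<omega>)))"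
  have D_pos: "0 < (\<Sum>j=1..K. w j * (A n (j - 1) \<omega> + A n j \<omega>))" if \<omega>: "\<omega> \<in> space M" for \<omega>
    using D_ge[OF \<omega>] mult_pos_pos[OF Suc.prems(2) A_pos[OF \<omega>, of 1 n]] by simp
  have jensen: "(f (\<omega>, \<omega>') - g \<omega>')\<^sup>2
      \<le> (\<Sum>j=1..K. \<nu> j \<omega>' * (ln (row (Suc n) \<omega> j * (1 - row (Suc n) \<omega> j)))\<^sup>2)"
    if \<omega>: "\<omega> \<in> space M" and \<omega>': "\<omega>' \<in> space M" for \<omega> \<omega>'
    unfolding f_def prod.case h_eq' g_def \<nu>_def
  proof (rule ln_ratio_square_le)
    fix j assume j: "j \<in> {1..K}"
    define r where "r = row (Suc n) \<omega> j"
    have r: "0 < r" "r < 1" using row_range[OF \<omega>] by (auto simp: r_def)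
    define a b where "a = A n (j - 1) \<omega>'" and "b = A n j \<omega>'"
    have ab: "0 \<le> a" "0 < b" using A_nonneg[OF \<omega>'] A_pos[OF \<omega>'] j by (auto simp: a_def b_def)
    show "0 \<le> w j" by (rule Suc.prems(1)[OF j])
    show "0 < A n (j - 1) \<omega>' + A n j \<omega>'" using ab by (simp add: a_def b_def)
    have rr: "r * (1 - r) \<le> r" "r * (1 - r) \<le> 1 - r"
      using r mult_left_le[of "1 - r" r] mult_left_le[of r "1 - r"] by (auto simp: mult.commute)
    have "r * (1 - r) \<le> 1" by (rule order.trans[OF rr(1) less_imp_le[OF r(2)]])
    moreover have "0 < r * (1 - r)" using r by simp
    ultimately show "0 < row (Suc n) \<omega> j * (1 - row (Suc n) \<omega> j) \<and> row (Suc n) \<omega> j * (1 - row (Suc n) \<omega> j) \<le> 1"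
      unfolding r_def by blast
    have "r * (1 - r) * (a + b) \<le> r * a + (1 - r) * b"
      using mult_right_mono[OF rr(1) ab(1)] mult_right_mono[OF rr(2) less_imp_le[OF ab(2)]]
      by (simp add: distrib_left)
    moreover have "r * a + (1 - r) * b \<le> a + b"
    proof -
      have "0 \<le> (1 - r) * a" "0 \<le> r * b" using r ab by simp_all
      then show ?thesis by (simp add: algebra_simps)
    qed
    ultimately show "row (Suc n) \<omega> j * (1 - row (Suc n) \<omega> j) * (A n (j - 1) \<omega>' + A n j \<omega>')
          \<le> row (Suc n) \<omega> j * A n (j - 1) \<omega>' + (1 - row (Suc n) \<omega> j) * A n j \<omega>'
        \<and> row (Suc n) \<omega> j * A n (j - 1) \<omega>' + (1 - row (Suc n) \<omega> j) * A n j \<omega>'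
          \<le> A n (j - 1) \<omega>' + A n j \<omega>'"
      by (simp add: r_def a_def b_def)
  qed (use D_pos[OF \<omega>'] in auto)
  have sq_fg: "square_integrable (M \<Otimes>\<^sub>M M) (\<lambda>z. f z - g (snd z))"
    by (intro square_integrable_diff sq_f pair.square_integrable_snd sq_g)
  \<comment> \<open>For fixed lower rows the weights \<open>\<nu> j\<close> are constants with sum \<open>1\<close>.\<close>
  have inner: "expectation (\<lambda>\<omega>. (f (\<omega>, \<omega>') - g \<omega>')\<^sup>2) \<le> row_cost" if \<omega>': "\<omega>' \<in> space M" for \<omega>'
  proof -
    let ?l = "\<lambda>\<omega> j. (ln (row (Suc n) \<omega> j * (1 - row (Suc n) \<omega> j)))\<^sup>2"
    have \<nu>: "0 \<le> \<nu> j \<omega>'" if j: "j \<in> {1..K}" for j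
      unfolding \<nu>_def using Suc.prems(1)[OF j] A_nonneg[OF \<omega>'] D_pos[OF \<omega>']
      by (intro divide_nonneg_nonneg mult_nonneg_nonneg add_nonneg_nonneg) auto
    have \<nu>1: "(\<Sum>j=1..K. \<nu> j \<omega>') = 1"
      unfolding \<nu>_def using D_pos[OF \<omega>'] by (simp flip: sum_divide_distrib)
    have int: "integrable M (\<lambda>\<omega>. \<Sum>j=1..K. \<nu> j \<omega>' * ?l \<omega> j)"
      by (intro Bochner_Integration.integrable_sum integrable_mult_right
          square_integrableD square_integrable_row_cost)
    have "(\<lambda>\<omega>. f (\<omega>, \<omega>')) \<in> borel_measurable M"
      by (rule measurable_Pair1[OF square_integrable_measurable[OF sq_f] \<omega>'])
    then have "integrable M (\<lambda>\<omega>. (f (\<omega>, \<omega>') - g \<omega>')\<^sup>2)"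
      using jensen[OF _ \<omega>'] order.trans[OF jensen[OF _ \<omega>'] abs_ge_self]
      by (intro Bochner_Integration.integrable_bound[OF int]) auto
    then have "expectation (\<lambda>\<omega>. (f (\<omega>, \<omega>') - g \<omega>')\<^sup>2) \<le> expectation (\<lambda>\<omega>. \<Sum>j=1..K. \<nu> j \<omega>' * ?l \<omega> j)"
      using int jensen[OF _ \<omega>'] by (intro integral_mono) auto
    also have "\<dots> = (\<Sum>j=1..K. \<nu> j \<omega>' * expectation (\<lambda>\<omega>. ?l \<omega> j))"
      by (subst Bochner_Integration.integral_sum)
         (auto intro!: integrable_mult_right square_integrableD square_integrable_row_cost)
    also have "\<dots> \<le> (\<Sum>j=1..K. \<nu> j \<omega>' * row_cost)"
      by (intro sum_mono mult_left_mono expectation_row_cost \<nu>)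
    also have "\<dots> = row_cost"
      using \<nu>1 by (simp flip: sum_distrib_right)
    finally show ?thesis .
  qed
  have dist: "pair.expectation (\<lambda>z. (f z - g (snd z))\<^sup>2) \<le> row_cost"
  proof -
    have int: "integrable (M \<Otimes>\<^sub>M M) (case_prod (\<lambda>\<omega> \<omega>'. (f (\<omega>, \<omega>') - g \<omega>')\<^sup>2))"
      using square_integrableD[OF sq_fg] by (simp add: case_prod_beta')
    have "pair.expectation (\<lambda>z. (f z - g (snd z))\<^sup>2)
        = expectation (\<lambda>\<omega>'. expectation (\<lambda>\<omega>. (f (\<omega>, \<omega>') - g \<omega>')\<^sup>2))"
      using pair.integral_snd[OF int] by (simp add: case_prod_beta')
    also have "\<dots> \<le> expectation (\<lambda>\<omega>'. row_cost)"
      using pair.integrable_snd[OF int] by (intro integral_mono inner) auto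
    finally show ?thesis by (simp add: prob_space)
  qed
  have "pair.variance f \<le> real n * row_cost + row_cost"
  proof (rule pair.variance_le_fibre_variance[OF sq_f sq_g _ _ dist])
    fix \<omega> assume \<omega>: "\<omega> \<in> space M"
    note pb = sum_pull_back_pos[OF Suc.prems row_range[OF \<omega>, of "Suc n"]]
    show "square_integrable M (\<lambda>\<omega>'. f (\<omega>, \<omega>'))"
      unfolding f_def prod.case h_eq by (rule square_integrable_ln_weighted) (use pb in auto)
    show "variance (\<lambda>\<omega>'. f (\<omega>, \<omega>')) \<le> real n * row_cost"
      unfolding f_def prod.case h_eq by (rule Suc.IH) (use pb in auto)
  qed
  moreover have "variance X = pair.variance f"
  proof -
    have m: "expectation X = pair.expectation f"
      using integral_decouple[OF UV h] by (simp add: X_eq[abs_def] f_def)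
    have "(\<lambda>z. (h z - c)\<^sup>2) \<in> borel_measurable (Pi\<^sub>M R (\<lambda>_. borel) \<Otimes>\<^sub>M Pi\<^sub>M T (\<lambda>_. borel))" for c
      by measurable
    from integral_decouple[OF UV this, of "expectation X"] show ?thesis
      unfolding m[symmetric] by (simp add: X_eq[abs_def] f_def case_prod_beta')
  qed
  ultimately show ?case
    by (simp add: X_def algebra_simps)
qed

corollary variance_ln_A_le:
  assumes "1 \<le> k"
  shows "variance (\<lambda>\<omega>. ln (A n k \<omega>)) \<le> real n * row_cost"
proof -
  have "(\<Sum>j=1..k. (if j = k then 1 else 0) * A n j \<omega>) = A n k \<omega>" for \<omega>
    using assms by (subst sum.remove[of _ k]) (auto intro!: sum.neutral)
  moreover have "0 < (\<Sum>j=1..k. (if j = k then 1 else 0 :: real))"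
    using assms by simp
  ultimately show ?thesis
    using variance_ln_weighted_le[of k "\<lambda>j. if j = k then 1 else 0" n] by simp
qed

section \<open>The mean of the logarithm is superadditive\<close>

lemma prob_space_law: "\<lbrakk>1 \<le> j; j \<le> i\<rbrakk> \<Longrightarrow> prob_space (distr M borel (P i j))"
  by (intro prob_space_distr measurable_P)

text \<open>
  Every subarray that is read off along an injective reindexing has the same law; it is applied to the
  identity and to the shift of the apex of the triangle.
\<close>

lemma distr_subarray:
  assumes t: "inj_on t I" "t \<in> I \<rightarrow> {(i, j). 1 \<le> j \<and> j \<le> i}"
  shows "distr M (Pi\<^sub>M I (\<lambda>_. borel)) (\<lambda>\<omega>. \<lambda>z\<in>I. (case t z of (i, j) \<Rightarrow> P i j) \<omega>)
    = Pi\<^sub>M I (\<lambda>_. distr M borel (P 1 1))"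
proof -
  define T where "T = {(i :: nat, j). 1 \<le> j \<and> j \<le> i}"
  define X where "X = (\<lambda>(i, j). P i j)"
  define law where "law = distr M borel (P 1 1)"
  have sets_law: "sets law = sets borel" by (simp add: law_def)
  have prob_law: "prob_space law"
    unfolding law_def by (rule prob_space_law) auto
  have X: "X z \<in> borel_measurable M" "distr M borel (X z) = law" if z: "z \<in> T" for z
  proof -
    obtain i j where ij: "z = (i, j)" "1 \<le> j" "j \<le> i"
      using z by (auto simp: T_def)
    show "X z \<in> borel_measurable M" "distr M borel (X z) = law"
      unfolding X_def law_def ij(1) prod.case by (rule measurable_P identical, fact, fact)+
  qed
  have "(1, 1) \<in> T" by (simp add: T_def)
  then have "T \<noteq> {}" by blast
  then have "distr M (Pi\<^sub>M T (\<lambda>_. borel)) (\<lambda>\<omega>. \<lambda>z\<in>T. X z \<omega>) = (\<Pi>\<^sub>M z\<in>T. distr M borel (X z))"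
    using indep_vars_iff_distr_eq_PiM'[where I = T and M' = "\<lambda>_. borel" and X = X] X(1) indep
    by (simp add: T_def X_def)
  also have "\<dots> = Pi\<^sub>M T (\<lambda>_. law)"
    by (intro PiM_cong refl X(2))
  finally have joint: "distr M (Pi\<^sub>M T (\<lambda>_. borel)) (\<lambda>\<omega>. \<lambda>z\<in>T. X z \<omega>) = Pi\<^sub>M T (\<lambda>_. law)" .
  have t': "t \<in> I \<rightarrow> T" using t(2) by (simp add: T_def)
  have meas: "(\<lambda>\<omega>. \<lambda>z\<in>I. \<omega> (t z)) \<in> measurable (Pi\<^sub>M T (\<lambda>_. borel)) (Pi\<^sub>M I (\<lambda>_. borel))"
    using t' by (intro measurable_restrict measurable_component_singleton) auto
  have "Pi\<^sub>M I (\<lambda>_. law) = distr (Pi\<^sub>M T (\<lambda>_. law)) (Pi\<^sub>M I (\<lambda>_. law)) (\<lambda>\<omega>. \<lambda>z\<in>I. \<omega> (t z))"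
    using distr_PiM_reindex[of T "\<lambda>_. law", OF prob_law t(1) t'] by simp
  also have "\<dots> = distr (Pi\<^sub>M T (\<lambda>_. law)) (Pi\<^sub>M I (\<lambda>_. borel)) (\<lambda>\<omega>. \<lambda>z\<in>I. \<omega> (t z))"
    by (intro distr_cong refl sets_PiM_cong sets_law)
  also have "\<dots> = distr (distr M (Pi\<^sub>M T (\<lambda>_. borel)) (\<lambda>\<omega>. \<lambda>z\<in>T. X z \<omega>)) (Pi\<^sub>M I (\<lambda>_. borel)) (\<lambda>\<omega>. \<lambda>z\<in>I. \<omega> (t z))"
    by (simp add: joint)
  also have "\<dots> = distr M (Pi\<^sub>M I (\<lambda>_. borel)) ((\<lambda>\<omega>. \<lambda>z\<in>I. \<omega> (t z)) \<circ> (\<lambda>\<omega>. \<lambda>z\<in>T. X z \<omega>))"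
    using X(1) by (intro distr_distr meas measurable_restrict) auto
  also have "(\<lambda>\<omega>. \<lambda>z\<in>I. \<omega> (t z)) \<circ> (\<lambda>\<omega>. \<lambda>z\<in>T. X z \<omega>) = (\<lambda>\<omega>. \<lambda>z\<in>I. X (t z) \<omega>)"
    using t' by (auto simp: fun_eq_iff)
  finally show ?thesis unfolding X_def law_def by (rule sym)
qed

lemma
  assumes "k \<le> n"
  shows integrable_ln_shift:
      "1 \<le> l \<Longrightarrow> integrable M (\<lambda>\<omega>. ln (break_point (\<lambda>i j. P (n + i) (k + j) \<omega>) m l))"
    and expectation_ln_shift:
      "expectation (\<lambda>\<omega>. ln (break_point (\<lambda>i j. P (n + i) (k + j) \<omega>) m l)) = expectation (\<lambda>\<omega>. ln (A m l \<omega>))"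
proof -
  define \<phi> where "\<phi> = (\<lambda>v :: nat \<times> nat \<Rightarrow> real. ln (break_point (\<lambda>i j. v (i, j)) m l))"
  define N where "N = Pi\<^sub>M (triangle m) (\<lambda>_. distr M borel (P 1 1))"
  have \<phi> [measurable]: "\<phi> \<in> borel_measurable (Pi\<^sub>M (triangle m) (\<lambda>_. borel))"
    unfolding \<phi>_def
    by (intro borel_measurable_ln borel_measurable_break_point measurable_component_singleton) auto
  have *: "(integrable M (\<lambda>\<omega>. \<phi> (\<lambda>z\<in>triangle m. (case t z of (i, j) \<Rightarrow> P i j) \<omega>)) \<longleftrightarrow> integrable N \<phi>)
      \<and> expectation (\<lambda>\<omega>. \<phi> (\<lambda>z\<in>triangle m. (case t z of (i, j) \<Rightarrow> P i j) \<omega>)) = integral\<^sup>L N \<phi>"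
    if t: "inj_on t (triangle m)" "t \<in> triangle m \<rightarrow> {(i, j). 1 \<le> j \<and> j \<le> i}" for t
  proof -
    have "(\<lambda>\<omega>. \<lambda>z\<in>triangle m. (case t z of (i, j) \<Rightarrow> P i j) \<omega>) \<in> measurable M (Pi\<^sub>M (triangle m) (\<lambda>_. borel))"
    proof (rule measurable_restrict)
      fix z assume "z \<in> triangle m"
      then have "t z \<in> {(i, j). 1 \<le> j \<and> j \<le> i}" using t(2) by (rule funcset_mem[rotated])
      then show "(\<lambda>\<omega>. (case t z of (i, j) \<Rightarrow> P i j) \<omega>) \<in> borel_measurable M"
        using measurable_P by (cases "t z") auto
    qed
    from integrable_distr_eq[OF this \<phi>] integral_distr[OF this \<phi>] show ?thesis
      unfolding distr_subarray[OF t] N_def by simp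
  qed
  have shift: "\<phi> (\<lambda>z\<in>triangle m. (case (case z of (i, j) \<Rightarrow> (n + i, k + j)) of (i, j) \<Rightarrow> P i j) \<omega>)
      = ln (break_point (\<lambda>i j. P (n + i) (k + j) \<omega>) m l)" for \<omega>
    unfolding \<phi>_def by (intro arg_cong[where f = ln] break_point_cong) simp
  have id: "\<phi> (\<lambda>z\<in>triangle m. (case z of (i, j) \<Rightarrow> P i j) \<omega>) = ln (A m l \<omega>)" for \<omega>
    unfolding \<phi>_def A_def by (intro arg_cong[where f = ln] break_point_cong) simp
  have 1: "(integrable M (\<lambda>\<omega>. ln (break_point (\<lambda>i j. P (n + i) (k + j) \<omega>) m l)) \<longleftrightarrow> integrable N \<phi>)
      \<and> expectation (\<lambda>\<omega>. ln (break_point (\<lambda>i j. P (n + i) (k + j) \<omega>) m l)) = integral\<^sup>L N \<phi>"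
  proof -
    have "inj_on (\<lambda>(i, j). (n + i, k + j)) (triangle m)"
      by (auto simp: inj_on_def)
    moreover have "(\<lambda>(i, j). (n + i, k + j)) \<in> triangle m \<rightarrow> {(i, j). 1 \<le> j \<and> j \<le> i}"
      using \<open>k \<le> n\<close> by auto
    ultimately show ?thesis using * unfolding shift[symmetric] by blast
  qed
  have 2: "(integrable M (\<lambda>\<omega>. ln (A m l \<omega>)) \<longleftrightarrow> integrable N \<phi>)
      \<and> expectation (\<lambda>\<omega>. ln (A m l \<omega>)) = integral\<^sup>L N \<phi>"
    unfolding id[symmetric] by (rule *) auto
  show "integrable M (\<lambda>\<omega>. ln (break_point (\<lambda>i j. P (n + i) (k + j) \<omega>) m l))" if "1 \<le> l"
    using 1 2 integrable_ln_A[OF that] by simp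
  show "expectation (\<lambda>\<omega>. ln (break_point (\<lambda>i j. P (n + i) (k + j) \<omega>) m l)) = expectation (\<lambda>\<omega>. ln (A m l \<omega>))"
    using 1 2 by simp
qed

text \<open>
  The shift of the position by one turns the inequality for break points into superadditivity on the
  cone \<open>k \<le> n\<close>.
\<close>

definition mean_ln :: "nat \<Rightarrow> nat \<Rightarrow> real" where
  "mean_ln n k = expectation (\<lambda>\<omega>. ln (A n (Suc k) \<omega>))"

definition mean_cost :: real where
  "mean_cost = - expectation (\<lambda>\<omega>. ln (1 - P 1 1 \<omega>))"

sublocale cone_superadditive mean_ln mean_cost
proof
  fix n m k l :: nat
  show "mean_ln n k + mean_ln m l \<le> mean_ln (n + m) (k + l)" if "k \<le> n" "l \<le> m"
  proof -
    let ?A' = "\<lambda>\<omega>. break_point (\<lambda>i j. P (n + i) (k + j) \<omega>) m (Suc l)"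
    have "mean_ln n k + mean_ln m l = expectation (\<lambda>\<omega>. ln (A n (Suc k) \<omega>) + ln (?A' \<omega>))"
      using integrable_ln_A[of "Suc k" n] integrable_ln_shift[OF \<open>k \<le> n\<close>, of "Suc l" m]
        expectation_ln_shift[OF \<open>k \<le> n\<close>, of m "Suc l"]
      by (simp add: mean_ln_def)
    also have "\<dots> \<le> expectation (\<lambda>\<omega>. ln (A (n + m) (Suc (k + l)) \<omega>))"
    proof (rule integral_mono)
      fix \<omega> assume \<omega>: "\<omega> \<in> space M"
      have pos: "0 < A n (Suc k) \<omega>" "0 < ?A' \<omega>"
        using A_pos[OF \<omega>] break_point_pos[OF proportions_shift[OF proportions[OF \<omega>] \<open>k \<le> n\<close>]] by auto
      then have "ln (A n (Suc k) \<omega>) + ln (?A' \<omega>) = ln (A n (Suc k) \<omega> * ?A' \<omega>)"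
        by (simp add: ln_mult)
      also have "\<dots> \<le> ln (A (n + m) (Suc (k + l)) \<omega>)"
        using pos break_point_supermultiplicative[OF proportions[OF \<omega>] \<open>k \<le> n\<close>, of m "Suc l"]
        by (intro ln_mono) (auto simp: A_def)
      finally show "ln (A n (Suc k) \<omega>) + ln (?A' \<omega>) \<le> ln (A (n + m) (Suc (k + l)) \<omega>)" .
    qed (use integrable_ln_A integrable_ln_shift[OF \<open>k \<le> n\<close>] in auto)
    finally show ?thesis by (simp add: mean_ln_def)
  qed
  show "mean_ln n k \<le> mean_ln n l" if "k \<le> l"
    unfolding mean_ln_def using that
    by (intro integral_mono integrable_ln_A ln_mono A_mono A_pos) auto
  show "mean_ln n k \<le> 0"
  proof -
    have "mean_ln n k \<le> expectation (\<lambda>\<omega>. 0)"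
      unfolding mean_ln_def using A_le_1 A_pos
      by (intro integral_mono integrable_ln_A) auto
    then show ?thesis by simp
  qed
  show "- mean_cost * real n \<le> mean_ln n k"
  proof -
    have int: "integrable M (\<lambda>\<omega>. ln (1 - P i 1 \<omega>))" if "i \<in> {1..n}" for i
      using integrable_identical[of "\<lambda>x. ln (1 - x)" 1 i] that
        square_integrable_imp_integrable'[OF square_integrable_ln_1] by simp
    have "- mean_cost * real n = (\<Sum>i=1..n. expectation (\<lambda>\<omega>. ln (1 - P i 1 \<omega>)))"
    proof -
      have "expectation (\<lambda>\<omega>. ln (1 - P i 1 \<omega>)) = - mean_cost" if "i \<in> {1..n}" for i
        using expectation_identical[of "\<lambda>x. ln (1 - x)" 1 i] that by (simp add: mean_cost_def)
      then have "(\<Sum>i=1..n. expectation (\<lambda>\<omega>. ln (1 - P i 1 \<omega>))) = (\<Sum>i=1..n. - mean_cost)"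
        by (intro sum.cong refl)
      then show ?thesis by simp
    qed
    also have "\<dots> = expectation (\<lambda>\<omega>. ln (A n 1 \<omega>))"
      using int by (simp only: ln_A_first Bochner_Integration.integral_sum cong: Bochner_Integration.integral_cong)
    also have "\<dots> \<le> mean_ln n k"
      unfolding mean_ln_def by (intro integral_mono integrable_ln_A ln_mono A_mono A_pos) auto
    finally show ?thesis .
  qed
qed

section \<open>Where the rate vanishes\<close>

definition mean_P :: real where
  "mean_P = expectation (P 1 1)"

lemma P_range: "\<lbrakk>\<omega> \<in> space M; 1 \<le> j; j \<le> i\<rbrakk> \<Longrightarrow> 0 < P i j \<omega> \<and> P i j \<omega> < 1"
  using proportionsD[OF proportions] by simp

lemma integrable_P: "\<lbrakk>1 \<le> j; j \<le> i\<rbrakk> \<Longrightarrow> integrable M (P i j)"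
  by (rule integrable_const_bound[where B = 1])
     (auto intro!: measurable_P AE_I2 simp: abs_le_iff dest!: P_range[of _ j i])

lemma integrable_A: "integrable M (A n k)"
  by (rule integrable_const_bound[where B = 1]) (auto simp: A_nonneg A_le_1)

lemma mean_P_range: "0 < mean_P" "mean_P < 1"
  using expectation_greater[OF integrable_P[of 1 1], of 0] expectation_less[OF integrable_P[of 1 1], of 1]
    P_range[of _ 1 1] by (auto simp: mean_P_def)

text \<open>
  A proportion is independent of the previous generation, so the mean break points follow the same
  recursion with the constant proportion \<open>mean_P\<close>.
\<close>

lemma expectation_A_Suc:
  assumes "k \<le> n"
  shows "expectation (A (Suc n) (Suc k)) = mean_P * expectation (A n k) + (1 - mean_P) * expectation (A n (Suc k))"
proof -
  have ij: "1 \<le> Suc k" "Suc k \<le> Suc n" using assms by auto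
  let ?p = "P (Suc n) (Suc k)"
  have E: "expectation ?p = mean_P"
    using expectation_identical[of "\<lambda>x. x", OF _ ij] by (simp add: mean_P_def)
  have indep_pA: "indep_var borel ?p borel (A n l)" for l
  proof -
    let ?R = "{(i, j). 1 \<le> j \<and> j \<le> i \<and> i = Suc n}"
    have "(\<lambda>u. u (Suc n, Suc k)) \<in> borel_measurable (Pi\<^sub>M ?R (\<lambda>_. borel :: real measure))"
      using assms by (intro measurable_component_singleton) auto
    moreover have "(\<lambda>v. break_point (\<lambda>i j. v (i, j)) n l) \<in> borel_measurable (Pi\<^sub>M (triangle n) (\<lambda>_. borel))"
      by (intro borel_measurable_break_point measurable_component_singleton) auto
    ultimately have "indep_var
        borel ((\<lambda>u. u (Suc n, Suc k)) \<circ> (\<lambda>\<omega>. restrict (\<lambda>(i, j). P i j \<omega>) ?R))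
        borel ((\<lambda>v. break_point (\<lambda>i j. v (i, j)) n l) \<circ> (\<lambda>\<omega>. restrict (\<lambda>(i, j). P i j \<omega>) (triangle n)))"
      by (rule indep_var_compose[OF indep_row_triangle])
    moreover have "(\<lambda>u. u (Suc n, Suc k)) \<circ> (\<lambda>\<omega>. restrict (\<lambda>(i, j). P i j \<omega>) ?R) = ?p"
      using assms by (auto simp: fun_eq_iff)
    moreover have "(\<lambda>v. break_point (\<lambda>i j. v (i, j)) n l) \<circ> (\<lambda>\<omega>. restrict (\<lambda>(i, j). P i j \<omega>) (triangle n)) = A n l"
      by (auto simp: fun_eq_iff A_def intro!: break_point_cong)
    ultimately show ?thesis by simp
  qed
  have pA: "expectation (\<lambda>\<omega>. ?p \<omega> * A n l \<omega>) = mean_P * expectation (A n l)"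
      "integrable M (\<lambda>\<omega>. ?p \<omega> * A n l \<omega>)" for l
    using indep_var_lebesgue_integral[OF indep_pA integrable_P[OF ij] integrable_A]
      indep_var_integrable[OF indep_pA integrable_P[OF ij] integrable_A] E by auto
  have "expectation (A (Suc n) (Suc k))
      = expectation (\<lambda>\<omega>. ?p \<omega> * A n k \<omega> + (A n (Suc k) \<omega> - ?p \<omega> * A n (Suc k) \<omega>))"
    using assms by (intro Bochner_Integration.integral_cong refl)
      (simp add: A_def break_point_Suc_Suc algebra_simps)
  also have "\<dots> = mean_P * expectation (A n k) + (expectation (A n (Suc k)) - mean_P * expectation (A n (Suc k)))"
    using pA integrable_A by simp
  finally show ?thesis by (simp add: algebra_simps)
qed

lemma expectation_A_0: "expectation (A n 0) = 0"
proof -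
  have "A n 0 = (\<lambda>\<omega>. 0)" by (simp add: fun_eq_iff A_def)
  then show ?thesis by simp
qed

lemma expectation_A_right: "n < k \<Longrightarrow> expectation (A n k) = 1"
proof -
  assume "n < k"
  then have "A n k = (\<lambda>\<omega>. 1)" by (simp add: fun_eq_iff A_def break_point_right)
  then show ?thesis by (simp add: prob_space)
qed

text \<open>
  The mean of \<open>A n k\<close> is the probability that a binomial variable with parameters \<open>n\<close> and
  \<open>mean_P\<close> is less than \<open>k\<close>. The Chernoff bounds for its two tails follow by induction from the
  recursion, with the generating function of a single Bernoulli variable as growth factor.
\<close>

definition bernoulli_pgf :: "real \<Rightarrow> real" where
  "bernoulli_pgf s = mean_P * s + (1 - mean_P)"

lemma expectation_A_upper:
  assumes "0 < s" "s \<le> 1"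
  shows "expectation (A n k) * s ^ k \<le> s * bernoulli_pgf s ^ n"
proof (induction n arbitrary: k)
  case 0
  show ?case
    using assms power_decreasing[of 1 k s] by (cases k) (auto simp: expectation_A_0 expectation_A_right)
next
  case (Suc n)
  define \<rho> where "\<rho> = bernoulli_pgf s"
  have "mean_P * s + (1 - mean_P) * s \<le> \<rho>"
    unfolding \<rho>_def bernoulli_pgf_def using assms mean_P_range by (intro add_mono) (auto intro!: mult_left_le)
  then have \<rho>: "s \<le> \<rho>" by (simp add: algebra_simps)
  consider "k = 0" | j where "k = Suc j" "j \<le> n" | j where "k = Suc j" "Suc n \<le> j"
    by (metis not_less_eq_eq old.nat.exhaust)
  then show ?case
  proof cases
    case 1
    then show ?thesis using assms \<rho> by (simp add: expectation_A_0 \<rho>_def)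
  next
    case (2 j)
    have "expectation (A (Suc n) k) * s ^ k
        = mean_P * s * (expectation (A n j) * s ^ j) + (1 - mean_P) * (expectation (A n (Suc j)) * s ^ Suc j)"
      unfolding 2 expectation_A_Suc[OF 2(2)] by (simp add: algebra_simps)
    also have "\<dots> \<le> mean_P * s * (s * \<rho> ^ n) + (1 - mean_P) * (s * \<rho> ^ n)"
      using assms mean_P_range Suc.IH[of j] Suc.IH[of "Suc j"] unfolding \<rho>_def
      by (intro add_mono mult_left_mono) auto
    also have "\<dots> = s * \<rho> ^ Suc n"
      by (simp add: \<rho>_def bernoulli_pgf_def algebra_simps)
    finally show ?thesis by (simp add: \<rho>_def)
  next
    case (3 j)
    have "s ^ k \<le> s ^ Suc (Suc n)"
      using assms 3 by (intro power_decreasing) auto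
    also have "\<dots> \<le> s * \<rho> ^ Suc n"
      using assms \<rho> by (auto intro!: mult_left_mono power_mono simp del: power_Suc simp: power_Suc[of s "Suc n"])
    finally show ?thesis
      using 3 by (simp add: expectation_A_right \<rho>_def)
  qed
qed

lemma expectation_A_lower:
  assumes "1 \<le> s"
  shows "(1 - expectation (A n k)) * s ^ k \<le> bernoulli_pgf s ^ n"
proof (induction n arbitrary: k)
  case 0
  show ?case
    by (cases k) (auto simp: expectation_A_0 expectation_A_right)
next
  case (Suc n)
  define \<rho> where "\<rho> = bernoulli_pgf s"
  have "mean_P * 1 + (1 - mean_P) \<le> \<rho>"
    unfolding \<rho>_def bernoulli_pgf_def using assms mean_P_range by (intro add_mono mult_left_mono) auto
  then have \<rho>: "1 \<le> \<rho>" by simp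
  consider "k = 0" | j where "k = Suc j" "j \<le> n" | "Suc n < k"
    by (metis less_Suc_eq_le not_less_eq not0_implies_Suc)
  then show ?case
  proof cases
    case 1
    then show ?thesis using \<rho> one_le_power[OF \<rho>, of "Suc n"] by (simp add: expectation_A_0 \<rho>_def)
  next
    case (2 j)
    have "(1 - expectation (A (Suc n) k)) * s ^ k
        = mean_P * s * ((1 - expectation (A n j)) * s ^ j)
          + (1 - mean_P) * ((1 - expectation (A n (Suc j))) * s ^ Suc j)"
      unfolding 2 expectation_A_Suc[OF 2(2)] by (simp add: algebra_simps)
    also have "\<dots> \<le> mean_P * s * \<rho> ^ n + (1 - mean_P) * \<rho> ^ n"
      using assms mean_P_range Suc.IH[of j] Suc.IH[of "Suc j"] unfolding \<rho>_def
      by (intro add_mono mult_left_mono) auto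
    also have "\<dots> = \<rho> ^ Suc n"
      by (simp add: \<rho>_def bernoulli_pgf_def algebra_simps)
    finally show ?thesis by (simp add: \<rho>_def)
  next
    case 3
    then show ?thesis using \<rho> by (simp add: expectation_A_right \<rho>_def del: power_Suc)
  qed
qed

lemma bernoulli_pgf_pos: "0 < s \<Longrightarrow> 0 < bernoulli_pgf s"
  unfolding bernoulli_pgf_def using mean_P_range by (intro add_pos_pos mult_pos_pos) auto

lemma chernoff_exponent_deriv:
  "((\<lambda>s. ln (bernoulli_pgf s) - x * ln s) has_real_derivative mean_P - x) (at 1)"
  unfolding bernoulli_pgf_def by (auto intro!: derivative_eq_intros)

lemma chernoff_exponent_1: "ln (bernoulli_pgf 1) - x * ln 1 = 0"
  by (simp add: bernoulli_pgf_def)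

text \<open>
  The mean logarithm is at most the logarithm of the mean, and the mean decays exponentially. The exponent
  \<open>ln (bernoulli_pgf s) - x * ln s\<close> vanishes at \<open>s = 1\<close> with derivative \<open>mean_P - x\<close>, so some \<open>s < 1\<close>
  makes it negative if \<open>x < mean_P\<close>, and some \<open>s > 1\<close> if \<open>x > mean_P\<close>.
\<close>

lemma rate_neg:
  assumes "0 \<le> x" "x < mean_P"
  shows "rate x < 0"
proof -
  obtain d where d: "0 < d" "\<And>h. \<lbrakk>0 < h; h < d\<rbrakk> \<Longrightarrow> ln (bernoulli_pgf (1 - h)) - x * ln (1 - h) < 0"
    using DERIV_pos_inc_left[OF chernoff_exponent_deriv[of x]] assms chernoff_exponent_1[of x] by auto
  define s where "s = 1 - min (d / 2) (1 / 2)"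
  have s: "0 < s" "s \<le> 1" and neg: "ln (bernoulli_pgf s) - x * ln s < 0"
    using d(1) d(2)[of "min (d / 2) (1 / 2)"] by (auto simp: s_def)
  have "rate x \<le> ln (bernoulli_pgf s) - x * ln s"
  proof (rule rate_le[OF assms(1)])
    fix n k assume nk: "1 \<le> n" "k \<le> n" "real k \<le> real n * x"
    define c where "c = bernoulli_pgf s ^ n / s ^ k"
    have c: "0 < c" using s bernoulli_pgf_pos by (simp add: c_def)
    have EA: "expectation (A n (Suc k)) \<le> c"
      using expectation_A_upper[OF s, of n "Suc k"] s by (simp add: c_def field_simps)
    \<comment> \<open>The tangent of \<open>ln\<close> at \<open>c\<close> takes the place of Jensen's inequality.\<close>
    have "mean_ln n k \<le> expectation (\<lambda>\<omega>. A n (Suc k) \<omega> / c + (ln c - 1))"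
      unfolding mean_ln_def
    proof (rule integral_mono)
      fix \<omega> assume \<omega>: "\<omega> \<in> space M"
      have pos: "0 < A n (Suc k) \<omega>" by (rule A_pos[OF \<omega>]) simp
      then have "ln (A n (Suc k) \<omega> / c) \<le> A n (Suc k) \<omega> / c - 1"
        using c by (intro ln_le_minus_one) simp
      then show "ln (A n (Suc k) \<omega>) \<le> A n (Suc k) \<omega> / c + (ln c - 1)"
        using pos c by (simp add: ln_div)
    qed (use integrable_A integrable_ln_A in auto)
    also have "\<dots> = expectation (A n (Suc k)) / c + (ln c - 1)"
      using integrable_A by (simp add: prob_space)
    also have "\<dots> \<le> ln c"
      using EA c by simp
    also have "ln c = real n * ln (bernoulli_pgf s) + real k * (- ln s)"
      using s bernoulli_pgf_pos[of s] by (simp add: c_def ln_div ln_realpow)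
    also have "\<dots> \<le> real n * ln (bernoulli_pgf s) + real n * x * (- ln s)"
      using nk s by (intro add_left_mono mult_right_mono) auto
    finally show "mean_ln n k \<le> real n * (ln (bernoulli_pgf s) - x * ln s)"
      by (simp add: algebra_simps)
  qed
  with neg show ?thesis by simp
qed

text \<open>
  For \<open>x > mean_P\<close> the mean of \<open>A n k\<close> tends to \<open>1\<close>, whereas a negative rate would give its
  logarithm a mean of order \<open>- n\<close>. Since the standard deviation is only of order \<open>\<surd>n\<close>, the two are
  incompatible.
\<close>

lemma rate_zero:
  assumes "mean_P < x" "x \<le> 1"
  shows "rate x = 0"
proof (rule ccontr)
  have x0: "0 \<le> x" using assms mean_P_range by simp
  assume "rate x \<noteq> 0"
  then have r: "rate x < 0" using rate_nonpos[OF x0] by simp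
  obtain d where d: "0 < d" "\<And>h. \<lbrakk>0 < h; h < d\<rbrakk> \<Longrightarrow> ln (bernoulli_pgf (1 + h)) - x * ln (1 + h) < 0"
    using DERIV_neg_dec_right[OF chernoff_exponent_deriv[of x]] assms chernoff_exponent_1[of x] by auto
  define s where "s = 1 + d / 2"
  define \<eta> where "\<eta> = ln (bernoulli_pgf s) - x * ln s"
  have s: "1 \<le> s" and neg: "\<eta> < 0"
    using d(1) d(2)[of "d / 2"] by (auto simp: s_def \<eta>_def)
  \<comment> \<open>At each point either the logarithm deviates from its mean by half of \<open>n \<bar>rate x\<bar>\<close> or \<open>A n (Suc k) \<le> 1/2\<close>.\<close>
  have bound: "1 \<le> 4 * row_cost / (rate x)\<^sup>2 / real n + 2 * exp \<eta> ^ n"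
    if n: "1 \<le> n" "2 * ln 2 \<le> real n * (- rate x)" for n
  proof -
    define k where "k = nat \<lfloor>real n * x\<rfloor>"
    have k: "real k \<le> real n * x" "real n * x \<le> real (Suc k)"
      using x0 unfolding k_def by (auto intro: of_nat_floor) linarith
    have "real n * x \<le> real n * 1" using assms by (intro mult_left_mono) auto
    then have "k \<le> n" using k(1) by simp
    define m where "m = mean_ln n k"
    have m: "m \<le> real n * rate x"
      unfolding m_def by (rule rate_upper[OF \<open>k \<le> n\<close> k(1)])
    define b where "b = (real n * rate x)\<^sup>2"
    have b: "0 < b" using n r by (simp add: b_def)
    have sq: "square_integrable M (\<lambda>\<omega>. ln (A n (Suc k) \<omega>) - m)"
      by (intro square_integrable_diff square_integrable_ln_A square_integrable_const) simp
    have "(1 :: real) = expectation (\<lambda>\<omega>. 1)" by (simp add: prob_space)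
    also have "\<dots> \<le> expectation (\<lambda>\<omega>. 4 * (ln (A n (Suc k) \<omega>) - m)\<^sup>2 / b + 2 * (1 - A n (Suc k) \<omega>))"
    proof (rule integral_mono)
      fix \<omega> assume \<omega>: "\<omega> \<in> space M"
      show "1 \<le> 4 * (ln (A n (Suc k) \<omega>) - m)\<^sup>2 / b + 2 * (1 - A n (Suc k) \<omega>)"
      proof (cases "A n (Suc k) \<omega> \<le> 1 / 2")
        case True
        moreover have "0 \<le> 4 * (ln (A n (Suc k) \<omega>) - m)\<^sup>2 / b" using b by simp
        ultimately show ?thesis by argo
      next
        case False
        then have "ln (1 / 2) \<le> ln (A n (Suc k) \<omega>)" by (intro ln_mono) auto
        then have "- ln 2 \<le> ln (A n (Suc k) \<omega>)" by (simp add: ln_div)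
        then have "real n * (- rate x) \<le> 2 * (ln (A n (Suc k) \<omega>) - m)"
          using m n(2) by simp
        moreover have "0 \<le> real n * (- rate x)" using r by (intro mult_nonneg_nonneg) auto
        ultimately have "(real n * (- rate x))\<^sup>2 \<le> (2 * (ln (A n (Suc k) \<omega>) - m))\<^sup>2"
          by (intro power_mono)
        then have "b \<le> 4 * (ln (A n (Suc k) \<omega>) - m)\<^sup>2"
          unfolding b_def power_mult_distrib power2_minus by simp
        then have "1 \<le> 4 * (ln (A n (Suc k) \<omega>) - m)\<^sup>2 / b" using b by simp
        then show ?thesis using A_le_1[OF \<omega>, of n "Suc k"] by simp
      qed
    qed (use integrable_A square_integrableD[OF sq] in auto)
    also have "\<dots> = 4 * expectation (\<lambda>\<omega>. (ln (A n (Suc k) \<omega>) - m)\<^sup>2) / b + 2 * (1 - expectation (A n (Suc k)))"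
      using integrable_A square_integrableD[OF sq] by (simp add: prob_space)
    also have "\<dots> \<le> 4 * (real n * row_cost) / b + 2 * exp \<eta> ^ n"
    proof (intro add_mono divide_right_mono mult_left_mono)
      show "expectation (\<lambda>\<omega>. (ln (A n (Suc k) \<omega>) - m)\<^sup>2) \<le> real n * row_cost"
        using variance_ln_A_le[of "Suc k" n] by (simp add: m_def mean_ln_def)
      have "1 - expectation (A n (Suc k)) \<le> bernoulli_pgf s ^ n / s ^ Suc k"
        using expectation_A_lower[OF s, of n "Suc k"] s by (simp add: pos_le_divide_eq del: power_Suc)
      also have "\<dots> = exp (real n * ln (bernoulli_pgf s) - real (Suc k) * ln s)"
        using s bernoulli_pgf_pos[of s] by (simp add: exp_diff exp_of_nat_mult del: power_Suc of_nat_Suc)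
      also have "\<dots> \<le> exp (real n * \<eta>)"
        using mult_right_mono[OF k(2), of "ln s"] s by (simp add: \<eta>_def algebra_simps)
      finally show "1 - expectation (A n (Suc k)) \<le> exp \<eta> ^ n"
        by (simp add: exp_of_nat_mult)
    qed (use b in auto)
    also have "4 * (real n * row_cost) / b = 4 * row_cost / (rate x)\<^sup>2 / real n"
      using n r by (simp add: b_def power_mult_distrib power2_eq_square)
    finally show ?thesis .
  qed
  have "filterlim (\<lambda>n. real n * (- rate x)) at_top sequentially"
    using r by (intro filterlim_at_top_mult_tendsto_pos[OF tendsto_const _ filterlim_real_sequentially]) auto
  then have "eventually (\<lambda>n. 2 * ln 2 \<le> real n * (- rate x)) sequentially"
    by (simp add: filterlim_at_top)
  with eventually_ge_at_top[of 1]
  have ev: "eventually (\<lambda>n. 1 \<le> 4 * row_cost / (rate x)\<^sup>2 / real n + 2 * exp \<eta> ^ n) sequentially"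
    by eventually_elim (rule bound)
  have "(\<lambda>n. 4 * row_cost / (rate x)\<^sup>2 / real n + 2 * exp \<eta> ^ n) \<longlonglongrightarrow> 0 + 2 * 0"
    using neg by (intro tendsto_intros lim_const_over_n LIMSEQ_realpow_zero) auto
  from tendsto_lowerbound[OF this ev] show False by simp
qed

section \<open>Almost sure convergence along the squares\<close>

lemma AE_tendsto_zero_if_summable_square:
  assumes Y: "\<And>n. square_integrable M (Y n)"
    and "summable (\<lambda>n. expectation (\<lambda>\<omega>. (Y n \<omega>)\<^sup>2))"
  shows "AE \<omega> in M. (\<lambda>n. Y n \<omega>) \<longlonglongrightarrow> 0"
proof -
  note [measurable] = square_integrable_measurable[OF Y]
  have "(\<integral>\<^sup>+\<omega>. (\<Sum>n. ennreal ((Y n \<omega>)\<^sup>2)) \<partial>M) = (\<Sum>n. \<integral>\<^sup>+\<omega>. ennreal ((Y n \<omega>)\<^sup>2) \<partial>M)"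
    by (intro nn_integral_suminf) auto
  also have "\<dots> = (\<Sum>n. ennreal (expectation (\<lambda>\<omega>. (Y n \<omega>)\<^sup>2)))"
    using square_integrableD[OF Y] by (simp add: nn_integral_eq_integral)
  also have "\<dots> = ennreal (\<Sum>n. expectation (\<lambda>\<omega>. (Y n \<omega>)\<^sup>2))"
    using assms(2) by (intro suminf_ennreal2) auto
  finally have "(\<integral>\<^sup>+\<omega>. (\<Sum>n. ennreal ((Y n \<omega>)\<^sup>2)) \<partial>M) \<noteq> \<infinity>" by simp
  then have "AE \<omega> in M. (\<Sum>n. ennreal ((Y n \<omega>)\<^sup>2)) \<noteq> \<infinity>"
    by (intro nn_integral_noteq_infinite) auto
  then show ?thesis
  proof eventually_elim
    case (elim \<omega>)
    then have "summable (\<lambda>n. (Y n \<omega>)\<^sup>2)"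
      by (intro summable_suminf_not_top) auto
    then have "(\<lambda>n. (Y n \<omega>)\<^sup>2) \<longlonglongrightarrow> 0"
      by (rule summable_LIMSEQ_zero)
    then show ?case
      using tendsto_real_sqrt[of "\<lambda>n. (Y n \<omega>)\<^sup>2" 0 sequentially]
      by (simp add: tendsto_rabs_zero_iff)
  qed
qed

text \<open>
  At time \<open>N\<^sup>2\<close> the normalised logarithm has a variance of order \<open>1 / N\<^sup>2\<close>, which is summable.
\<close>

lemma AE_squares:
  assumes x: "0 \<le> x" "x \<le> 1"
  shows "AE \<omega> in M. (\<lambda>N. ln (A (N\<^sup>2) (Suc (nat \<lfloor>real (N\<^sup>2) * x\<rfloor>)) \<omega>) / real (N\<^sup>2)) \<longlonglongrightarrow> rate x"
proof -
  define k where "k = (\<lambda>N. nat \<lfloor>real (N\<^sup>2) * x\<rfloor>)"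
  define Y where "Y = (\<lambda>N \<omega>. (ln (A (N\<^sup>2) (Suc (k N)) \<omega>) - mean_ln (N\<^sup>2) (k N)) / real (N\<^sup>2))"
  have sq: "square_integrable M (\<lambda>\<omega>. ln (A (N\<^sup>2) (Suc (k N)) \<omega>) - mean_ln (N\<^sup>2) (k N))" for N
    by (intro square_integrable_diff square_integrable_ln_A square_integrable_const) simp
  have sqY: "square_integrable M (Y N)" for N
    using sq[of N] by (auto simp: square_integrable_def Y_def power_divide)
  have Y2: "expectation (\<lambda>\<omega>. (Y N \<omega>)\<^sup>2) \<le> row_cost * (1 / real N ^ 2)" for N
  proof (cases "N = 0")
    case False
    have "expectation (\<lambda>\<omega>. (Y N \<omega>)\<^sup>2)
        = expectation (\<lambda>\<omega>. (ln (A (N\<^sup>2) (Suc (k N)) \<omega>) - mean_ln (N\<^sup>2) (k N))\<^sup>2) / (real (N\<^sup>2))\<^sup>2"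
      by (simp add: Y_def power_divide)
    also have "\<dots> \<le> real (N\<^sup>2) * row_cost / (real (N\<^sup>2))\<^sup>2"
      using variance_ln_A_le[of "Suc (k N)" "N\<^sup>2"]
      by (intro divide_right_mono) (auto simp: mean_ln_def)
    also have "\<dots> = row_cost * (1 / real N ^ 2)"
      using False by (simp add: power2_eq_square)
    finally show ?thesis .
  qed (simp add: Y_def)
  have "summable (\<lambda>N. expectation (\<lambda>\<omega>. (Y N \<omega>)\<^sup>2))"
  proof (rule summable_comparison_test')
    show "summable (\<lambda>N. row_cost * (1 / real N ^ 2))"
      using inverse_power_summable[of 2, where 'a = real]
      by (intro summable_mult) (simp add: inverse_eq_divide)
    show "norm (expectation (\<lambda>\<omega>. (Y N \<omega>)\<^sup>2)) \<le> row_cost * (1 / real N ^ 2)" if "0 \<le> N" for N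
      using Y2[of N] by simp
  qed
  from AE_tendsto_zero_if_summable_square[OF sqY this]
  show ?thesis
  proof eventually_elim
    case (elim \<omega>)
    have "filterlim (\<lambda>N :: nat. N\<^sup>2) sequentially sequentially"
      by (intro filterlim_subseq strict_monoI) (simp add: power_strict_mono)
    then have "(\<lambda>N. mean_ln (N\<^sup>2) (k N) / real (N\<^sup>2)) \<longlonglongrightarrow> rate x"
      unfolding k_def by (rule filterlim_compose[OF F_over_n_tendsto_rate[OF x]])
    from tendsto_add[OF elim this] show ?case
      by (simp add: Y_def k_def diff_divide_distrib)
  qed
qed

end

section \<open>From the squares to all times\<close>

lemma filterlim_floor_sqrt: "filterlim floor_sqrt sequentially sequentially"
  unfolding filterlim_at_top
  by (auto intro!: eventually_sequentiallyI le_floor_sqrtI)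

lemma floor_sqrt_square_gap: "n \<le> (floor_sqrt n)\<^sup>2 + 2 * floor_sqrt n"
  using Suc_floor_sqrt_power2_gt[of n] by (simp add: power2_eq_square)

lemma floor_sqrt_square_ratio_tendsto: "(\<lambda>n. real ((floor_sqrt n)\<^sup>2) / real n) \<longlonglongrightarrow> 1"
proof (rule tendsto_sandwich)
  have "1 - 2 / real (floor_sqrt n) \<le> real ((floor_sqrt n)\<^sup>2) / real n" if "1 \<le> n" for n
  proof -
    define s where "s = floor_sqrt n"
    have s: "0 < s" "s\<^sup>2 \<le> n" "n \<le> s\<^sup>2 + 2 * s"
      using that floor_sqrt_square_gap[of n] by (auto simp: s_def)
    have "real s * real s \<le> real n"
      using s(2) by (simp add: power2_eq_square flip: of_nat_mult)
    then have "real s \<le> real n / real s" using s(1) by (simp add: field_simps)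
    moreover have "real n \<le> real (s\<^sup>2) + 2 * real s"
      using s(3) by (metis of_nat_add of_nat_le_iff of_nat_mult of_nat_numeral)
    ultimately have "real n - 2 * (real n / real s) \<le> real (s\<^sup>2)" by simp
    then have "(real n - 2 * (real n / real s)) / real n \<le> real (s\<^sup>2) / real n"
      by (intro divide_right_mono) auto
    then show ?thesis using that s(1) by (simp add: s_def diff_divide_distrib)
  qed
  then show "eventually (\<lambda>n. 1 - 2 / real (floor_sqrt n) \<le> real ((floor_sqrt n)\<^sup>2) / real n) sequentially"
    by (rule eventually_sequentiallyI)
  have "real ((floor_sqrt n)\<^sup>2) / real n \<le> 1" for n
    using floor_sqrt_power2_le[of n] by (cases "n = 0") (simp_all add: divide_le_eq_1 del: of_nat_power)
  then show "eventually (\<lambda>n. real ((floor_sqrt n)\<^sup>2) / real n \<le> 1) sequentially"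
    by simp
  have "(\<lambda>n. 1 - 2 / real (floor_sqrt n)) \<longlonglongrightarrow> 1 - 0"
    by (intro tendsto_intros filterlim_compose[OF lim_const_over_n filterlim_floor_sqrt])
  then show "(\<lambda>n. 1 - 2 / real (floor_sqrt n)) \<longlonglongrightarrow> 1" by simp
qed simp

text \<open>
  Between two consecutive squares the time grows by at most \<open>2 \<surd>n\<close>. By interlacing, a break point
  at time \<open>n\<close> lies between break points at the preceding square whose indices differ by at most
  that amount, hence between those that belong to neighbouring rational values of \<open>u\<close>.
\<close>

lemma ln_break_point_tendsto_if_squares:
  assumes P: "proportions P" and cont: "continuous_on {0<..<1} r" and u: "0 < u" "u < 1"
    and squares: "\<And>x. x \<in> \<rat> \<Longrightarrow> 0 < x \<Longrightarrow> x < 1 \<Longrightarrow>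
      (\<lambda>N. ln (break_point P (N\<^sup>2) (Suc (nat \<lfloor>real (N\<^sup>2) * x\<rfloor>))) / real (N\<^sup>2)) \<longlonglongrightarrow> r x"
  shows "(\<lambda>n. ln (break_point P n (Suc (nat \<lfloor>real n * u\<rfloor>))) / real n) \<longlonglongrightarrow> r u"
proof -
  define a where "a n = ln (break_point P n (Suc (nat \<lfloor>real n * u\<rfloor>))) / real n" for n
  define b where "b x n = ln (break_point P ((floor_sqrt n)\<^sup>2) (Suc (nat \<lfloor>real ((floor_sqrt n)\<^sup>2) * x\<rfloor>))) / real n" for x n
  have b_lim: "b x \<longlonglongrightarrow> r x" if x: "x \<in> \<rat>" "0 < x" "x < 1" for x
  proof -
    have "(\<lambda>n. ln (break_point P ((floor_sqrt n)\<^sup>2) (Suc (nat \<lfloor>real ((floor_sqrt n)\<^sup>2) * x\<rfloor>))) / real ((floor_sqrt n)\<^sup>2)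
        * (real ((floor_sqrt n)\<^sup>2) / real n)) \<longlonglongrightarrow> r x * 1"
      by (intro tendsto_mult floor_sqrt_square_ratio_tendsto
          filterlim_compose[OF squares[OF x] filterlim_floor_sqrt])
    moreover have "eventually (\<lambda>n. ln (break_point P ((floor_sqrt n)\<^sup>2) (Suc (nat \<lfloor>real ((floor_sqrt n)\<^sup>2) * x\<rfloor>)))
        / real ((floor_sqrt n)\<^sup>2) * (real ((floor_sqrt n)\<^sup>2) / real n) = b x n) sequentially"
      by (intro eventually_sequentiallyI[of 1]) (simp add: b_def del: of_nat_power)
    ultimately show ?thesis
      by (simp add: tendsto_cong)
  qed
  have ev_sqrt: "eventually (\<lambda>n. c \<le> real (floor_sqrt n)) sequentially" for c
    by (rule filterlim_at_top[THEN iffD1, rule_format,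
        OF filterlim_compose[OF filterlim_real_sequentially filterlim_floor_sqrt]])
  have upper: "eventually (\<lambda>n. a n \<le> b y n) sequentially" if y: "u < y" "y < 1" for y
    using ev_sqrt[of "2 * u / (y - u)"]
  proof eventually_elim
    case (elim n)
    define s where "s = floor_sqrt n"
    have s: "s\<^sup>2 \<le> n" "n \<le> s\<^sup>2 + 2 * s"
      using floor_sqrt_square_gap[of n] by (auto simp: s_def)
    have "2 * u \<le> real s * (y - u)"
      using elim y by (simp add: s_def field_simps)
    then have "real s * (2 * u) \<le> real s * (real s * (y - u))"
      by (intro mult_left_mono) auto
    moreover have "real n * u \<le> (real s * real s + 2 * real s) * u"
      using s(2) u by (intro mult_right_mono) (simp_all add: power2_eq_square flip: of_nat_mult of_nat_add)
    ultimately have "real n * u \<le> real (s\<^sup>2) * y"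
      by (simp add: power2_eq_square algebra_simps)
    then have "nat \<lfloor>real n * u\<rfloor> \<le> nat \<lfloor>real (s\<^sup>2) * y\<rfloor>"
      by (intro nat_mono floor_mono)
    then have le: "Suc (nat \<lfloor>real n * u\<rfloor>) \<le> Suc (nat \<lfloor>real (s\<^sup>2) * y\<rfloor>)"
      by (rule Suc_leI[OF le_imp_less_Suc])
    have "break_point P n (Suc (nat \<lfloor>real n * u\<rfloor>)) \<le> break_point P (s\<^sup>2) (Suc (nat \<lfloor>real n * u\<rfloor>))"
      using break_point_decreasing[OF P, of "s\<^sup>2" "n - s\<^sup>2"] s(1) by simp
    also have "\<dots> \<le> break_point P (s\<^sup>2) (Suc (nat \<lfloor>real (s\<^sup>2) * y\<rfloor>))"
      by (rule break_point_mono[OF P le])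
    finally show ?case
      unfolding a_def b_def s_def[symmetric]
      by (intro divide_right_mono ln_mono break_point_pos[OF P]) auto
  qed
  have lower: "eventually (\<lambda>n. b x n \<le> a n) sequentially" if x: "0 < x" "x < u" for x
    using ev_sqrt[of "2 / (u - x)"]
  proof eventually_elim
    case (elim n)
    define s where "s = floor_sqrt n"
    have s: "s\<^sup>2 \<le> n" "n \<le> s\<^sup>2 + 2 * s"
      using floor_sqrt_square_gap[of n] by (auto simp: s_def)
    define d where "d = n - s\<^sup>2"
    have n: "n = s\<^sup>2 + d" and d: "d \<le> 2 * s" using s by (auto simp: d_def)
    have "2 \<le> real s * (u - x)"
      using elim x by (simp add: s_def field_simps)
    then have "real s * 2 \<le> real s * (real s * (u - x))"
      by (intro mult_left_mono) auto
    then have "real (s\<^sup>2) * x + 2 * real s \<le> real (s\<^sup>2) * u"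
      by (simp add: power2_eq_square algebra_simps)
    also have "\<dots> \<le> real n * u"
      using u by (intro mult_right_mono) (simp_all add: n del: of_nat_power)
    finally have "real (s\<^sup>2) * x + real d \<le> real n * u"
      using d by linarith
    moreover have "real (nat \<lfloor>real (s\<^sup>2) * x\<rfloor>) \<le> real (s\<^sup>2) * x"
      using x by (intro of_nat_floor) auto
    ultimately have "real (nat \<lfloor>real (s\<^sup>2) * x\<rfloor> + d) \<le> real n * u"
      unfolding of_nat_add by linarith
    then have "nat \<lfloor>real (s\<^sup>2) * x\<rfloor> + d \<le> nat \<lfloor>real n * u\<rfloor>"
      by (rule le_nat_floor)
    then have le: "Suc (nat \<lfloor>real (s\<^sup>2) * x\<rfloor>) + d \<le> Suc (nat \<lfloor>real n * u\<rfloor>)"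
      by simp
    have "break_point P (s\<^sup>2) (Suc (nat \<lfloor>real (s\<^sup>2) * x\<rfloor>)) \<le> break_point P n (Suc (nat \<lfloor>real (s\<^sup>2) * x\<rfloor>) + d)"
      unfolding n by (rule break_point_increasing_diagonal[OF P])
    also have "\<dots> \<le> break_point P n (Suc (nat \<lfloor>real n * u\<rfloor>))"
      by (rule break_point_mono[OF P le])
    finally show ?case
      unfolding a_def b_def s_def[symmetric]
      by (intro divide_right_mono ln_mono break_point_pos[OF P]) auto
  qed
  have near: "\<exists>e>0. \<forall>x\<in>{0<..<1}. \<bar>x - u\<bar> < e \<longrightarrow> \<bar>r x - r u\<bar> < \<epsilon>" if "0 < \<epsilon>" for \<epsilon>
    using cont u that by (auto simp: continuous_on_iff dist_real_def)
  have "a \<longlonglongrightarrow> r u"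
  proof (rule order_tendstoI)
    fix z assume "z < r u"
    then obtain e where e: "0 < e" "\<And>x. \<lbrakk>x \<in> {0<..<1}; \<bar>x - u\<bar> < e\<rbrakk> \<Longrightarrow> \<bar>r x - r u\<bar> < r u - z"
      using near[of "r u - z"] by auto
    obtain x where x: "x \<in> \<rat>" "max 0 (u - e) < x" "x < u"
      using Rats_dense_in_real[of "max 0 (u - e)" u] e(1) u by auto
    have "z < r x" using e(2)[of x] x u by auto
    then have "eventually (\<lambda>n. z < b x n) sequentially"
      using x u by (intro order_tendstoD(1)[OF b_lim]) auto
    with lower[of x] show "eventually (\<lambda>n. z < a n) sequentially"
      using x by (auto elim: eventually_elim2)
  next
    fix z assume "r u < z"
    then obtain e where e: "0 < e" "\<And>x. \<lbrakk>x \<in> {0<..<1}; \<bar>x - u\<bar> < e\<rbrakk> \<Longrightarrow> \<bar>r x - r u\<bar> < z - r u"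
      using near[of "z - r u"] by auto
    obtain y where y: "y \<in> \<rat>" "u < y" "y < min 1 (u + e)"
      using Rats_dense_in_real[of u "min 1 (u + e)"] e(1) u by auto
    have "r y < z" using e(2)[of y] y u by auto
    then have "eventually (\<lambda>n. b y n < z) sequentially"
      using y u by (intro order_tendstoD(2)[OF b_lim]) auto
    with upper[of y] show "eventually (\<lambda>n. a n < z) sequentially"
      using y by (auto elim: eventually_elim2)
  qed
  then show ?thesis by (simp add: a_def[abs_def])
qed

section \<open>Weak convergence of empirical distributions\<close>

abbreviation uniform_01 :: "real measure" where
  "uniform_01 \<equiv> restrict_space lborel {0<..<1}"

lemma prob_space_uniform_01: "prob_space uniform_01"
  by (rule prob_spaceI) (simp add: emeasure_restrict_space space_restrict_space)

lemma measurable_cell: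
  assumes "1 \<le> n"
  shows "(\<lambda>u. Suc (nat \<lfloor>real n * u\<rfloor>)) \<in> measurable uniform_01 (count_space {1..n})"
proof -
  let ?cell = "\<lambda>u. Suc (nat \<lfloor>real n * u\<rfloor>)"
  have "?cell u \<in> {1..n}" if "u \<in> {0<..<1}" for u
  proof -
    have "real n * u < real n" using that assms by simp
    then have "\<lfloor>real n * u\<rfloor> < int n" by (simp add: floor_less_iff)
    then show ?thesis using assms by simp
  qed
  moreover have "?cell \<in> measurable borel (count_space UNIV)"
    by measurable
  then have "?cell \<in> measurable uniform_01 (count_space UNIV)"
    by (intro measurable_restrict_space1) simp
  ultimately show ?thesis
    by (auto simp: measurable_count_space_eq2 space_restrict_space measurable_def)
qed

text \<open>
  This realises all empirical distributions on one probability space, so that their weak convergence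
  follows from pointwise convergence.
\<close>

lemma distr_uniform_01_cell:
  assumes "1 \<le> n"
  shows "distr uniform_01 (count_space {1..n}) (\<lambda>u. Suc (nat \<lfloor>real n * u\<rfloor>)) = uniform_count_measure {1..n}"
proof (rule measure_eqI_finite)
  let ?cell = "\<lambda>u. Suc (nat \<lfloor>real n * u\<rfloor>)"
  note meas = measurable_cell[OF assms]
  fix k assume k: "k \<in> {1..n}"
  define S where "S = ?cell -` {k} \<inter> {0<..<1}"
  have S_sets: "S \<in> sets uniform_01"
    using measurable_sets[OF meas, of "{k}"] k by (simp add: S_def space_restrict_space)
  have S: "{real (k - 1) / real n <..< real k / real n} \<subseteq> S" "S \<subseteq> {real (k - 1) / real n .. real k / real n}"
  proof -
    show "{real (k - 1) / real n <..< real k / real n} \<subseteq> S"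
    proof
      fix u assume "u \<in> {real (k - 1) / real n <..< real k / real n}"
      then have u: "real (k - 1) < real n * u" "real n * u < real k"
        using assms by (auto simp: field_simps)
      have "real n * u < real n" by (rule less_le_trans[OF u(2)]) (use k in simp)
      then have "u < 1" by (simp add: mult_less_cancel_left2)
      moreover have "0 < real n * u" using u(1) by (rule le_less_trans[OF of_nat_0_le_iff])
      then have "0 < u" using assms by (simp add: zero_less_mult_iff)
      moreover have "\<lfloor>real n * u\<rfloor> = int (k - 1)"
        using u k by (intro floor_unique) (auto simp: of_nat_diff)
      then have "Suc (nat \<lfloor>real n * u\<rfloor>) = k"
        using k by (simp only: nat_int) simp
      ultimately show "u \<in> S" by (simp add: S_def)
    qed
    show "S \<subseteq> {real (k - 1) / real n .. real k / real n}"
    proof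
      fix u assume "u \<in> S"
      then have u: "0 < u" "Suc (nat \<lfloor>real n * u\<rfloor>) = k" by (auto simp: S_def)
      then have "real (k - 1) \<le> real n * u" "real n * u \<le> real k"
        by (auto simp: of_nat_floor) linarith
      then show "u \<in> {real (k - 1) / real n .. real k / real n}"
        using assms by (simp add: field_simps)
    qed
  qed
  have len: "real k / real n - real (k - 1) / real n = 1 / real n" "real (k - 1) / real n \<le> real k / real n"
    using k assms by (auto simp: field_simps of_nat_diff)
  have S_borel: "S \<in> sets lborel"
    using S_sets by (auto simp: sets_restrict_space)
  have "emeasure lborel S = ennreal (1 / real n)"
  proof (rule antisym)
    show "emeasure lborel S \<le> ennreal (1 / real n)"
      using emeasure_mono[OF S(2), of lborel] len by simp
    show "ennreal (1 / real n) \<le> emeasure lborel S"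
      using emeasure_mono[OF S(1) S_borel] len by simp
  qed
  moreover have "emeasure (distr uniform_01 (count_space {1..n}) ?cell) {k}
      = emeasure uniform_01 (?cell -` {k} \<inter> space uniform_01)"
    by (rule emeasure_distr[OF meas]) (use k in simp)
  moreover have "?cell -` {k} \<inter> space uniform_01 = S"
    by (simp add: S_def space_restrict_space)
  moreover have "emeasure uniform_01 S = emeasure lborel S"
    by (rule emeasure_restrict_space) (auto simp: S_def)
  ultimately have "emeasure (distr uniform_01 (count_space {1..n}) ?cell) {k} = ennreal (1 / real n)"
    by (simp only:)
  also have "\<dots> = emeasure (uniform_count_measure {1..n}) {k}"
    using k by (subst emeasure_uniform_count_measure) auto
  finally show "emeasure (distr uniform_01 (count_space {1..n}) ?cell) {k} = emeasure (uniform_count_measure {1..n}) {k}" .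
qed (auto simp: sets_uniform_count_measure)

lemma transformed_empirical_eq_distr_uniform:
  assumes "1 \<le> n"
  shows "transformed_empirical P n
    = distr uniform_01 borel (\<lambda>u. transformed_point P n (Suc (nat \<lfloor>real n * u\<rfloor>)))"
proof -
  have "(\<lambda>u. Suc (nat \<lfloor>real n * u\<rfloor>)) \<in> measurable uniform_01 (count_space {1..n})"
    by (rule measurable_cell[OF assms])
  then have "distr (distr uniform_01 (count_space {1..n}) (\<lambda>u. Suc (nat \<lfloor>real n * u\<rfloor>))) borel (transformed_point P n)
      = distr uniform_01 borel (transformed_point P n \<circ> (\<lambda>u. Suc (nat \<lfloor>real n * u\<rfloor>)))"
    by (intro distr_distr) simp_all
  then show ?thesis
    unfolding transformed_empirical_def distr_uniform_01_cell[OF assms] by (simp add: comp_def)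
qed

lemma measurable_transformed_point_cell:
  "1 \<le> n \<Longrightarrow> (\<lambda>u. transformed_point P n (Suc (nat \<lfloor>real n * u\<rfloor>))) \<in> borel_measurable uniform_01"
  by (rule measurable_compose[OF measurable_cell]) simp_all

lemma weak_conv_transformed_empirical:
  assumes r: "r \<in> borel_measurable uniform_01"
    and lim: "\<And>u. \<lbrakk>0 < u; u < 1\<rbrakk> \<Longrightarrow> (\<lambda>n. transformed_point P n (Suc (nat \<lfloor>real n * u\<rfloor>))) \<longlonglongrightarrow> r u"
  shows "weak_conv_m (transformed_empirical P) (distr uniform_01 borel r)"
proof -
  interpret U: prob_space uniform_01 by (rule prob_space_uniform_01)
  define Y where "Y n u = transformed_point P (Suc n) (Suc (nat \<lfloor>real (Suc n) * u\<rfloor>))" for n u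
  have Y: "Y n \<in> borel_measurable uniform_01" for n
    unfolding Y_def[abs_def] by (rule measurable_transformed_point_cell) simp
  have emp: "transformed_empirical P (Suc n) = distr uniform_01 borel (Y n)" for n
    using transformed_empirical_eq_distr_uniform[of "Suc n" P] by (simp add: Y_def[abs_def])
  have "weak_conv_m (\<lambda>n. transformed_empirical P (Suc n)) (distr uniform_01 borel r)"
    unfolding emp
  proof (rule integral_bdd_continuous_conv_imp_weak_conv)
    show "real_distribution (distr uniform_01 borel (Y n))" for n
      by (rule U.real_distribution_distr) (rule Y)
    show "real_distribution (distr uniform_01 borel r)"
      by (rule U.real_distribution_distr) (rule r)
    fix f :: "real \<Rightarrow> real"
    assume f: "\<And>x. isCont f x" "\<And>x. \<bar>f x\<bar> \<le> 1"
    have [measurable]: "f \<in> borel_measurable borel"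
      using f(1) by (intro borel_measurable_continuous_onI continuous_at_imp_continuous_on) auto
    note [measurable] = Y r
    have "(\<lambda>n. integral\<^sup>L uniform_01 (\<lambda>u. f (Y n u))) \<longlonglongrightarrow> integral\<^sup>L uniform_01 (\<lambda>u. f (r u))"
    proof (rule integral_dominated_convergence[where w = "\<lambda>_. 1"])
      have "(\<lambda>n. f (Y n u)) \<longlonglongrightarrow> f (r u)" if "u \<in> space uniform_01" for u
        unfolding Y_def using that
        by (intro isCont_tendsto_compose[OF f(1)] LIMSEQ_Suc[OF lim]) (auto simp: space_restrict_space)
      then show "AE u in uniform_01. (\<lambda>n. f (Y n u)) \<longlonglongrightarrow> f (r u)"
        by (rule AE_I2)
    qed (use f(2) in auto)
    then show "(\<lambda>n. integral\<^sup>L (distr uniform_01 borel (Y n)) f) \<longlonglongrightarrow> integral\<^sup>L (distr uniform_01 borel r) f"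
      by (simp add: integral_distr)
  qed
  then show ?thesis
    unfolding weak_conv_m_def weak_conv_def by (blast intro: LIMSEQ_imp_Suc)
qed

context iid_proportions
begin

section \<open>The limit law\<close>

definition limit_law :: "real measure" where
  "limit_law = distr uniform_01 borel (\<lambda>u. exp (rate u))"

lemma measurable_exp_rate: "(\<lambda>u. exp (rate u)) \<in> borel_measurable uniform_01"
proof -
  have 1: "(\<lambda>u. exp (rate u)) \<in> borel_measurable (restrict_space borel {0<..<1})"
    by (intro borel_measurable_continuous_on_restrict continuous_intros rate_continuous)
  have 2: "sets uniform_01 = sets (restrict_space borel {0<..<1})"
    by (rule sets_restrict_space_cong) simp
  show ?thesis unfolding measurable_cong_sets[OF 2 refl] by (rule 1)
qed

lemma real_distribution_limit_law: "real_distribution limit_law"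
  unfolding limit_law_def
  by (rule prob_space.real_distribution_distr[OF prob_space_uniform_01]) (rule measurable_exp_rate)

lemma emeasure_limit_law:
  assumes "B \<in> sets borel"
  shows "emeasure limit_law B = emeasure lborel {u \<in> {0<..<1}. exp (rate u) \<in> B}"
    and "{u \<in> {0<..<1}. exp (rate u) \<in> B} \<in> sets lborel"
proof -
  define S where "S = {u \<in> {0<..<1}. exp (rate u) \<in> B}"
  have eq: "(\<lambda>u. exp (rate u)) -` B \<inter> space uniform_01 = S"
    by (auto simp: space_restrict_space S_def)
  have "S \<in> sets uniform_01"
    using measurable_sets[OF measurable_exp_rate assms] unfolding eq .
  then have "S \<in> sets lborel"
    by (subst (asm) sets_restrict_space_iff) auto
  then show "{u \<in> {0<..<1}. exp (rate u) \<in> B} \<in> sets lborel" by (simp only: S_def)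
  have "emeasure limit_law B = emeasure uniform_01 S"
    unfolding limit_law_def emeasure_distr[OF measurable_exp_rate assms] eq ..
  also have "\<dots> = emeasure lborel S"
    by (rule emeasure_restrict_space) (auto simp: S_def)
  finally show "emeasure limit_law B = emeasure lborel {u \<in> {0<..<1}. exp (rate u) \<in> B}"
    by (simp only: S_def)
qed

lemma limit_law_support:
  assumes "a \<le> exp (- mean_cost)"
  shows "measure limit_law {a..1} = 1"
proof -
  have "{u \<in> {0<..<1}. exp (rate u) \<in> {a..1}} = {0<..<1}"
    using assms rate_nonpos rate_lower by (auto intro: order.trans)
  then show ?thesis
    using emeasure_limit_law(1)[of "{a..1}"] by (simp add: measure_def)
qed

text \<open>
  The rate is strictly increasing where it is negative, so it takes each negative value at most once.
\<close>

lemma limit_law_no_atoms: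
  assumes "y < 1"
  shows "measure limit_law {y} = 0"
proof -
  define S where "S = {u \<in> {0<..<1}. exp (rate u) \<in> {y}}"
  have less: False if "u \<in> S" "v \<in> S" "u < v" for u v
  proof -
    \<comment> \<open>A point to the right of \<open>v\<close> where the rate vanishes.\<close>
    define z where "z = (1 + max mean_P v) / 2"
    have z: "v < z" "mean_P < z" "z \<le> 1"
      using that mean_P_range by (auto simp: z_def S_def)
    have "exp (rate v) < exp 0" using that assms by (simp add: S_def)
    then have "rate v < 0" by (simp only: exp_less_cancel_iff)
    then have "rate u < rate v"
      using that z by (intro rate_strict_mono[of u v z] rate_zero) (auto simp: S_def)
    moreover have "exp (rate u) = exp (rate v)" using that by (simp add: S_def)
    ultimately show False by simp
  qed
  have "S = {} \<or> (\<exists>u. S = {u})"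
    using less by (metis (no_types, lifting) insertI1 is_singletonI' is_singleton_def linorder_neqE_linordered_idom)
  then have "emeasure lborel S = 0" by auto
  then show ?thesis
    using emeasure_limit_law(1)[of "{y}"] by (simp add: measure_def S_def)
qed

lemma limit_law_at_1: "measure limit_law {1} = 1 - mean_P"
proof -
  define S where "S = {u \<in> {0<..<1}. exp (rate u) \<in> {1}}"
  have S: "{mean_P<..<1} \<subseteq> S" "S \<subseteq> {mean_P..1}"
  proof -
    show "{mean_P<..<1} \<subseteq> S"
      using rate_zero mean_P_range by (auto simp: S_def)
    show "S \<subseteq> {mean_P..1}"
    proof
      fix u assume "u \<in> S"
      then have "0 < u" "u < 1" "\<not> rate u < 0" by (auto simp: S_def)
      then show "u \<in> {mean_P..1}" using rate_neg[of u] by force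
    qed
  qed
  have sets: "S \<in> sets lborel"
    unfolding S_def by (rule emeasure_limit_law(2)) simp
  have "emeasure lborel S = ennreal (1 - mean_P)"
  proof (rule antisym)
    show "emeasure lborel S \<le> ennreal (1 - mean_P)"
      using emeasure_mono[OF S(2), of lborel] mean_P_range by simp
    show "ennreal (1 - mean_P) \<le> emeasure lborel S"
      using emeasure_mono[OF S(1) sets] mean_P_range by simp
  qed
  then show ?thesis
    using emeasure_limit_law(1)[of "{1}"] mean_P_range by (simp add: measure_def S_def)
qed

lemma AE_weak_conv_limit_law:
  "AE \<omega> in M. weak_conv_m (transformed_empirical (\<lambda>n k. P n k \<omega>)) limit_law"
proof -
  have "countable (\<rat> \<inter> {0<..<1 :: real})"
    by (intro countable_Int1 countable_rat)
  moreover have "AE \<omega> in M. (\<lambda>N. ln (A (N\<^sup>2) (Suc (nat \<lfloor>real (N\<^sup>2) * x\<rfloor>)) \<omega>) / real (N\<^sup>2)) \<longlonglongrightarrow> rate x"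
    if "x \<in> \<rat> \<inter> {0<..<1}" for x
    using that by (intro AE_squares) auto
  ultimately have "AE \<omega> in M. \<forall>x\<in>\<rat> \<inter> {0<..<1}.
      (\<lambda>N. ln (A (N\<^sup>2) (Suc (nat \<lfloor>real (N\<^sup>2) * x\<rfloor>)) \<omega>) / real (N\<^sup>2)) \<longlonglongrightarrow> rate x"
    by (subst AE_ball_countable) auto
  with AE_space show ?thesis
  proof eventually_elim
    case (elim \<omega>)
    let ?P = "\<lambda>n k. P n k \<omega>"
    show ?case
      unfolding limit_law_def
    proof (rule weak_conv_transformed_empirical[OF measurable_exp_rate])
      fix u :: real assume u: "0 < u" "u < 1"
      have "(\<lambda>n. ln (break_point ?P n (Suc (nat \<lfloor>real n * u\<rfloor>))) / real n) \<longlonglongrightarrow> rate u"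
        by (rule ln_break_point_tendsto_if_squares[OF proportions[OF elim(1)] rate_continuous u])
           (use elim(2) in \<open>auto simp: A_def\<close>)
      then have "(\<lambda>n. exp (ln (break_point ?P n (Suc (nat \<lfloor>real n * u\<rfloor>))) / real n)) \<longlonglongrightarrow> exp (rate u)"
        by (rule tendsto_exp)
      moreover have "eventually (\<lambda>n. exp (ln (break_point ?P n (Suc (nat \<lfloor>real n * u\<rfloor>))) / real n)
          = transformed_point ?P n (Suc (nat \<lfloor>real n * u\<rfloor>))) sequentially"
      proof (rule eventually_sequentiallyI[of 1])
        fix n :: nat assume "1 \<le> n"
        moreover have "0 < break_point ?P n (Suc (nat \<lfloor>real n * u\<rfloor>))"
          by (rule break_point_pos[OF proportions[OF elim(1)]]) simp
        ultimately show "exp (ln (break_point ?P n (Suc (nat \<lfloor>real n * u\<rfloor>))) / real n)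
            = transformed_point ?P n (Suc (nat \<lfloor>real n * u\<rfloor>))"
          by (simp add: transformed_point_def root_powr_inverse powr_def)
      qed
      ultimately show "(\<lambda>n. transformed_point ?P n (Suc (nat \<lfloor>real n * u\<rfloor>))) \<longlonglongrightarrow> exp (rate u)"
        by (rule Lim_transform_eventually)
    qed
  qed
qed

end

section \<open>Reduction to proportions in the open interval\<close>

lemma ln_square_le_abs_log_powr:
  assumes "2 < p"
  shows "ennreal ((ln x)\<^sup>2) \<le> 1 + abs_log_powr p x"
proof (cases "x = 0")
  case False
  have "(ln x)\<^sup>2 \<le> 1 + \<bar>ln x\<bar> powr p"
  proof (cases "\<bar>ln x\<bar> \<le> 1")
    case True
    then have "(ln x)\<^sup>2 \<le> 1" by (simp add: abs_square_le_1)
    then show ?thesis by (simp add: add_increasing2)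
  next
    case False
    then have "\<bar>ln x\<bar> powr 2 \<le> \<bar>ln x\<bar> powr p"
      using assms by (intro powr_mono) auto
    then show ?thesis using False by simp
  qed
  then have "ennreal ((ln x)\<^sup>2) \<le> ennreal (1 + \<bar>ln x\<bar> powr p)" by (rule ennreal_leI)
  then show ?thesis using False by (simp add: abs_log_powr_def ennreal_plus)
qed (simp add: abs_log_powr_def)

lemma measurable_abs_log_powr [measurable]: "abs_log_powr p \<in> borel_measurable borel"
  unfolding abs_log_powr_def by measurable

lemma (in prob_space) square_integrable_ln_if_abs_log_powr:
  assumes [measurable]: "X \<in> borel_measurable M" and "2 < p"
    and fin: "(\<integral>\<^sup>+\<omega>. abs_log_powr p (X \<omega>) \<partial>M) < \<infinity>"
  shows "square_integrable M (\<lambda>\<omega>. ln (X \<omega>))" and "AE \<omega> in M. X \<omega> \<noteq> 0"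
proof -
  have "(\<integral>\<^sup>+\<omega>. ennreal ((ln (X \<omega>))\<^sup>2) \<partial>M) \<le> (\<integral>\<^sup>+\<omega>. 1 + abs_log_powr p (X \<omega>) \<partial>M)"
    by (intro nn_integral_mono ln_square_le_abs_log_powr \<open>2 < p\<close>)
  also have "\<dots> = 1 + (\<integral>\<^sup>+\<omega>. abs_log_powr p (X \<omega>) \<partial>M)"
    by (subst nn_integral_add) (auto simp: emeasure_space_1)
  also have "\<dots> < \<infinity>" using fin by (simp add: ennreal_add_less_top)
  finally show "square_integrable M (\<lambda>\<omega>. ln (X \<omega>))"
    unfolding square_integrable_def by (auto intro!: integrableI_nonneg)
  have "AE \<omega> in M. abs_log_powr p (X \<omega>) \<noteq> \<infinity>"
    using fin by (intro nn_integral_noteq_infinite) auto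
  then show "AE \<omega> in M. X \<omega> \<noteq> 0"
    by eventually_elim (auto simp: abs_log_powr_def)
qed

lemma square_integrable_cong_AE:
  assumes "square_integrable M f" "g \<in> borel_measurable M" "AE x in M. g x = f x"
  shows "square_integrable M g"
proof -
  have "integrable M (\<lambda>x. (g x)\<^sup>2)"
    by (rule integrable_cong_AE_imp[OF square_integrableD[OF assms(1)]]) (use assms(2,3) in auto)
  then show ?thesis using assms(2) by (simp add: square_integrable_def)
qed

text \<open>
  Finiteness of the logarithmic moments excludes the values \<open>0\<close> and \<open>1\<close> almost surely. Replacing them by
  \<open>1/2\<close> changes nothing outside a null set and keeps the array independent and identically distributed.
\<close>

definition into_open_unit :: "real \<Rightarrow> real" where
  "into_open_unit x = (if 0 < x \<and> x < 1 then x else 1 / 2)"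

lemma into_open_unit_range: "0 < into_open_unit x \<and> into_open_unit x < 1"
  by (simp add: into_open_unit_def)

lemma measurable_into_open_unit [measurable]: "into_open_unit \<in> borel_measurable borel"
  unfolding into_open_unit_def by measurable

theorem theorem4p13:
  fixes M :: "'a measure" and P :: "nat \<Rightarrow> nat \<Rightarrow> 'a \<Rightarrow> real" and p :: real
  assumes "prob_space M"
    and "\<And>n k \<omega>. \<lbrakk>1 \<le> k; k \<le> n; \<omega> \<in> space M\<rbrakk> \<Longrightarrow> P n k \<omega> \<in> {0..1}"
    and "prob_space.indep_vars M (\<lambda>_. borel) (\<lambda>(n, k). P n k) {(n, k). 1 \<le> k \<and> k \<le> n}"
    and "\<And>n k. \<lbrakk>1 \<le> k; k \<le> n\<rbrakk> \<Longrightarrow> distr M borel (P n k) = distr M borel (P 1 1)"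
    and "p > 2"
    and "(\<integral>\<^sup>+ \<omega>. abs_log_powr p (P 1 1 \<omega>) \<partial>M) < \<infinity>"
    and "(\<integral>\<^sup>+ \<omega>. abs_log_powr p (1 - P 1 1 \<omega>) \<partial>M) < \<infinity>"
  shows "\<exists>g. real_distribution g \<and> measure g {0..1} = 1
    \<and> (AE \<omega> in M. weak_conv_m (transformed_empirical (\<lambda>n k. P n k \<omega>)) g)
    \<and> (\<exists>x. 0 < x \<and> x < 1 \<and> measure g {x..1} = 1)
    \<and> (\<forall>x\<in>{0..<1}. measure g {x} = 0)
    \<and> measure g {1} = 1 - (\<integral>\<omega>. P 1 1 \<omega> \<partial>M)"
proof -
  interpret prob_space M by fact
  have rv: "P i j \<in> borel_measurable M" if "1 \<le> j" "j \<le> i" for i j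
    using assms(3) that unfolding indep_vars_def by auto
  have rv11 [measurable]: "P 1 1 \<in> borel_measurable M" by (rule rv) auto
  have rv11': "(\<lambda>\<omega>. 1 - P 1 1 \<omega>) \<in> borel_measurable M" by measurable
  have sq: "square_integrable M (\<lambda>\<omega>. ln (P 1 1 \<omega>))" "square_integrable M (\<lambda>\<omega>. ln (1 - P 1 1 \<omega>))"
    and ne: "AE \<omega> in M. P 1 1 \<omega> \<noteq> 0" "AE \<omega> in M. 1 - P 1 1 \<omega> \<noteq> 0"
    by (rule square_integrable_ln_if_abs_log_powr[OF rv11 \<open>p > 2\<close> assms(6)]
        square_integrable_ln_if_abs_log_powr[OF rv11' \<open>p > 2\<close> assms(7)])+
  have AE11: "AE \<omega> in M. 0 < P 1 1 \<omega> \<and> P 1 1 \<omega> < 1"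
    using AE_space ne
  proof eventually_elim
    case (elim \<omega>)
    then show ?case using assms(2)[of 1 1 \<omega>] by auto
  qed
  have AE_ij: "AE \<omega> in M. 1 \<le> j \<longrightarrow> j \<le> i \<longrightarrow> 0 < P i j \<omega> \<and> P i j \<omega> < 1" for i j
  proof (cases "1 \<le> j \<and> j \<le> i")
    case True
    then have ij: "1 \<le> j" "j \<le> i" by auto
    have "AE x in distr M borel (P 1 1). 0 < x \<and> x < 1"
      by (subst AE_distr_iff[OF rv11]) (simp, rule AE11)
    then have "AE x in distr M borel (P i j). 0 < x \<and> x < 1"
      by (subst assms(4)[OF ij])
    then have "AE \<omega> in M. 0 < P i j \<omega> \<and> P i j \<omega> < 1"
      by (subst (asm) AE_distr_iff[OF rv[OF ij]]) auto
    then show ?thesis by eventually_elim simp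
  qed auto
  define Q where "Q = (\<lambda>i j \<omega>. into_open_unit (P i j \<omega>))"
  have AE_all: "AE \<omega> in M. \<forall>i j. 1 \<le> j \<longrightarrow> j \<le> i \<longrightarrow> Q i j \<omega> = P i j \<omega>"
    unfolding AE_all_countable
  proof (intro allI)
    fix i j
    from AE_ij[of j i] show "AE \<omega> in M. 1 \<le> j \<longrightarrow> j \<le> i \<longrightarrow> Q i j \<omega> = P i j \<omega>"
      by eventually_elim (simp add: Q_def into_open_unit_def)
  qed
  have Q11 [measurable]: "Q 1 1 \<in> borel_measurable M"
    unfolding Q_def by measurable
  have Q11_eq: "AE \<omega> in M. Q 1 1 \<omega> = P 1 1 \<omega>"
    using AE_all by eventually_elim simp
  interpret Q: iid_proportions M Q
  proof
    show "proportions (\<lambda>i j. Q i j \<omega>)" for \<omega>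
      by (simp add: proportions_def Q_def into_open_unit_range)
    have "indep_vars (\<lambda>_. borel) (\<lambda>z \<omega>. into_open_unit ((case z of (i, j) \<Rightarrow> P i j) \<omega>)) {(i, j). 1 \<le> j \<and> j \<le> i}"
      by (rule indep_vars_compose2[OF assms(3)]) simp
    moreover have "(\<lambda>z \<omega>. into_open_unit ((case z of (i, j) \<Rightarrow> P i j) \<omega>)) = (\<lambda>(i, j). Q i j)"
      by (auto simp: fun_eq_iff Q_def)
    ultimately show "indep_vars (\<lambda>_. borel) (\<lambda>(i, j). Q i j) {(i, j). 1 \<le> j \<and> j \<le> i}"
      by simp
    show "distr M borel (Q i j) = distr M borel (Q 1 1)" if "1 \<le> j" "j \<le> i" for i j
    proof -
      have "distr M borel (Q k l) = distr (distr M borel (P k l)) borel into_open_unit" if "1 \<le> l" "l \<le> k" for k l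
        using rv[OF that] by (subst distr_distr) (simp_all add: Q_def comp_def)
      from this[OF that] this[of 1 1] show ?thesis using assms(4)[OF that] by simp
    qed
    show "square_integrable M (\<lambda>\<omega>. ln (Q 1 1 \<omega>))"
    proof (rule square_integrable_cong_AE[OF sq(1)])
      show "(\<lambda>\<omega>. ln (Q 1 1 \<omega>)) \<in> borel_measurable M" by measurable
      show "AE \<omega> in M. ln (Q 1 1 \<omega>) = ln (P 1 1 \<omega>)" using Q11_eq by eventually_elim simp
    qed
    show "square_integrable M (\<lambda>\<omega>. ln (1 - Q 1 1 \<omega>))"
    proof (rule square_integrable_cong_AE[OF sq(2)])
      show "(\<lambda>\<omega>. ln (1 - Q 1 1 \<omega>)) \<in> borel_measurable M" by measurable
      show "AE \<omega> in M. ln (1 - Q 1 1 \<omega>) = ln (1 - P 1 1 \<omega>)" using Q11_eq by eventually_elim simp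
    qed
  qed
  have "AE \<omega> in M. weak_conv_m (transformed_empirical (\<lambda>n k. P n k \<omega>)) Q.limit_law"
    using AE_all Q.AE_weak_conv_limit_law
  proof eventually_elim
    case (elim \<omega>)
    have "break_point (\<lambda>i j. Q i j \<omega>) n k = break_point (\<lambda>i j. P i j \<omega>) n k" for n k
      using elim(1) by (intro break_point_cong) auto
    then have "transformed_empirical (\<lambda>i j. Q i j \<omega>) = transformed_empirical (\<lambda>i j. P i j \<omega>)"
      by (simp add: fun_eq_iff transformed_empirical_def transformed_point_def[abs_def])
    with elim(2) show ?case by simp
  qed
  moreover have "Q.mean_P = (\<integral>\<omega>. P 1 1 \<omega> \<partial>M)"
    unfolding Q.mean_P_def
    by (rule integral_cong_AE[OF Q11 rv11 Q11_eq])
  moreover have "measure Q.limit_law {exp (- Q.mean_cost - 1)..1} = 1"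
    by (rule Q.limit_law_support) simp
  moreover have "exp (- Q.mean_cost - 1) < 1"
    using Q.c_nonneg by simp
  moreover have "measure Q.limit_law {0..1} = 1"
    by (rule Q.limit_law_support) simp
  ultimately show ?thesis
    using Q.real_distribution_limit_law Q.limit_law_no_atoms Q.limit_law_at_1
    by (intro exI[of _ Q.limit_law] conjI) (auto intro!: exI[of _ "exp (- Q.mean_cost - 1)"])
qed

end
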